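(* Let $n\ge 3$ be an integer. There exists a constant $\varepsilon(n)<1$, depending only on $n$, such that for every $n$-dimensional compact smooth axis symmetric Riemannian manifold $(M,g)$, i.e. $M=[0,a]\times_f S^{n-1}$ with $g=dt^2+f(t)^2\,d\sigma^2$ where $d\sigma^2$ is the standard metric of $S^{n-1}$, satisfying $$\mathrm{Ric}_g\ge \varepsilon(n)\,(n-1)\,g\quad\text{and}\quad R_g\ge n(n-1),$$ we have $\mathrm{vol}(M)\le \mathrm{vol}(S^n)$.
   Context: $\mathrm{Ric}_g$, $R_g$ and $\mathrm{vol}(M)$ denote the Ricci curvature, scalar curvature and volume of $(M,g)$. $S^n$ carries the standard metric of constant sectional curvature $1$ (so its Ricci curvature is $(n-1)$ times the metric and its scalar curvature is $n(n-1)$), and $\mathrm{vol}(S^n)$ is its volume. In the warped product $[0,a]\times_f S^{n-1}$, $a>0$, $t\in[0,a]$, and $f\ge 0$ is a warping function with $f(0)=f(a)=0$ and $f>0$ on $(0,a)$; the slices $t=0$ and $t=a$ are collapsed to points, so that $M$ is a compact smooth manifold (a topological $n$-sphere) with $g$ a smooth Riemannian metric. *)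

theory Defs
  imports "HOL-Analysis.Analysis"
begin

section \<open>Smooth functions and Riemannian metrics in coordinates\<close>

definition partial :: "'n::finite \<Rightarrow> (real^'n \<Rightarrow> 'b::real_normed_vector) \<Rightarrow> real^'n \<Rightarrow> 'b" where
  "partial i F x = frechet_derivative F (at x) (axis i 1)"

primrec iter_partial :: "'n::finite list \<Rightarrow> (real^'n \<Rightarrow> real) \<Rightarrow> real^'n \<Rightarrow> real" where
  "iter_partial [] F = F"
| "iter_partial (i # js) F = partial i (iter_partial js F)"

text \<open>Meant for open U: there, all iterated partial derivatives being (totally) differentiable
  is the same as being of class C-infinity.\<close>

definition smooth_on :: "(real^'n::finite) set \<Rightarrow> (real^'n \<Rightarrow> real) \<Rightarrow> bool" where
  "smooth_on U F \<longleftrightarrow> (\<forall>js. iter_partial js F differentiable_on U)"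

text \<open>A metric on a coordinate domain is given by its component matrix.\<close>

definition riemannian_metric_on ::
    "(real^'n::finite) set \<Rightarrow> (real^'n \<Rightarrow> real^'n^'n) \<Rightarrow> bool" where
  "riemannian_metric_on U g \<longleftrightarrow>
     (\<forall>i j. smooth_on U (\<lambda>x. g x $ i $ j)) \<and>
     (\<forall>x\<in>U. transpose (g x) = g x \<and> (\<forall>v. v \<noteq> 0 \<longrightarrow> v \<bullet> (g x *v v) > 0))"

definition christoffel ::
    "(real^'n::finite \<Rightarrow> real^'n^'n) \<Rightarrow> 'n \<Rightarrow> 'n \<Rightarrow> 'n \<Rightarrow> real^'n \<Rightarrow> real" where
  "christoffel g k i j x =
     (1/2) * (\<Sum>l\<in>UNIV. matrix_inv (g x) $ k $ l *
       (partial i (\<lambda>y. g y $ j $ l) x + partial j (\<lambda>y. g y $ i $ l) x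
        - partial l (\<lambda>y. g y $ i $ j) x))"

text \<open>\<open>riemann g l k i j\<close> is the l-th component of
  \<open>R(e\<^sub>i, e\<^sub>j) e\<^sub>k\<close>, where \<open>R(X,Y) = [\<nabla>\<^sub>X, \<nabla>\<^sub>Y] - \<nabla>\<^bsub>[X,Y]\<^esub>\<close>.\<close>

definition riemann ::
    "(real^'n::finite \<Rightarrow> real^'n^'n) \<Rightarrow> 'n \<Rightarrow> 'n \<Rightarrow> 'n \<Rightarrow> 'n \<Rightarrow> real^'n \<Rightarrow> real" where
  "riemann g l k i j x =
     partial i (christoffel g l j k) x - partial j (christoffel g l i k) x
     + (\<Sum>m\<in>UNIV. christoffel g l i m x * christoffel g m j k x
                 - christoffel g l j m x * christoffel g m i k x)"

definition ricci :: "(real^'n::finite \<Rightarrow> real^'n^'n) \<Rightarrow> real^'n \<Rightarrow> real^'n^'n" where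
  "ricci g x = (\<chi> k j. \<Sum>i\<in>UNIV. riemann g i k i j x)"

definition scalar_curv :: "(real^'n::finite \<Rightarrow> real^'n^'n) \<Rightarrow> real^'n \<Rightarrow> real" where
  "scalar_curv g x = (\<Sum>i\<in>UNIV. \<Sum>j\<in>UNIV. matrix_inv (g x) $ i $ j * ricci g x $ i $ j)"

definition riem_volume :: "(real^'n::finite) set \<Rightarrow> (real^'n \<Rightarrow> real^'n^'n) \<Rightarrow> ennreal" where
  "riem_volume U g = (\<integral>\<^sup>+x\<in>U. ennreal (sqrt (det (g x))) \<partial>lborel)"

text \<open>Pullback of the Euclidean metric along a map F into an inner product space.\<close>

definition induced_metric ::
    "(real^'n::finite \<Rightarrow> 'b::real_inner) \<Rightarrow> real^'n \<Rightarrow> real^'n^'n" where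
  "induced_metric F x = (\<chi> i j. partial i F x \<bullet> partial j F x)"


section \<open>The round sphere\<close>

text \<open>Inverse stereographic projection. It parametrizes the unit sphere of
  \<open>\<real>\<^sup>n \<times> \<real>\<close>, of dimension n, up to a single point, which does not contribute to the volume.\<close>

definition inv_stereo :: "real^'n::finite \<Rightarrow> (real^'n) \<times> real" where
  "inv_stereo x = ((2 / (1 + (norm x)\<^sup>2)) *\<^sub>R x, ((norm x)\<^sup>2 - 1) / ((norm x)\<^sup>2 + 1))"

definition round_sphere_volume :: "'n::finite itself \<Rightarrow> ennreal" where
  "round_sphere_volume _ = riem_volume UNIV (induced_metric (inv_stereo :: real^'n \<Rightarrow> _))"


section \<open>Axis symmetric manifolds\<close>

text \<open>The coordinate expression of \<open>dt\<^sup>2 + f(t)\<^sup>2 d\<sigma>\<^sup>2\<close>, when the point with coordinates x is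
  \<open>(t x, \<sigma> x)\<close> with \<open>\<sigma>\<close> taking values in the unit sphere of \<open>\<real>\<^sup>n\<close>.\<close>

definition warped_metric ::
    "(real \<Rightarrow> real) \<Rightarrow> (real^'n::finite \<Rightarrow> real) \<Rightarrow> (real^'n \<Rightarrow> real^'n) \<Rightarrow> real^'n \<Rightarrow> real^'n^'n" where
  "warped_metric f t \<sigma> x = induced_metric t x + (f (t x))\<^sup>2 *\<^sub>R induced_metric \<sigma> x"

text \<open>The manifold \<open>[0,a] \<times>\<^sub>f S\<^bsup>n-1\<^esup>\<close> is covered by two charts, each with the open ball of
  radius a in \<open>\<real>\<^sup>n\<close> as coordinate domain:
  \<^item> x represents \<open>(t, \<sigma>) = (norm x, x / norm x)\<close>, and 0 is the pole \<open>t = 0\<close>;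
  \<^item> x represents \<open>(t, \<sigma>) = (a - norm x, x / norm x)\<close>, and 0 is the pole \<open>t = a\<close>.

  The transition map is \<open>x \<mapsto> (a - norm x) x / norm x\<close>, and the first chart misses only the pole
  \<open>t = a\<close>. As t and \<open>a - t\<close> are the distances to the poles, these charts are normal
  coordinates, so if the metric is smooth in some smooth structure extending
  that of \<open>(0,a) \<times> S\<^bsup>n-1\<^esup>\<close>, it is smooth in this one. In the
  predicate below, g and h are the components of the metric in the two charts; away from the poles
  they are given by the warped product, and the conditions at 0 say that
  the metric extends smoothly, as a metric, across the poles.\<close>

definition axis_symmetric_manifold ::
    "real \<Rightarrow> (real \<Rightarrow> real) \<Rightarrow> (real^'n::finite \<Rightarrow> real^'n^'n) \<Rightarrow> (real^'n \<Rightarrow> real^'n^'n) \<Rightarrow> bool" where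
  "axis_symmetric_manifold a f g h \<longleftrightarrow>
     a > 0 \<and> f 0 = 0 \<and> f a = 0 \<and> (\<forall>t\<in>{0<..<a}. f t > 0) \<and>
     riemannian_metric_on (ball 0 a) g \<and>
     (\<forall>x\<in>ball 0 a - {0}. g x = warped_metric f norm sgn x) \<and>
     riemannian_metric_on (ball 0 a) h \<and>
     (\<forall>x\<in>ball 0 a - {0}. h x = warped_metric f (\<lambda>y. a - norm y) sgn x)"

end

theory Submission
  imports Defs
begin

text \<open>Write n for the dimension and \<open>W = \<integral> sin\<^sup>n\<^sup>-\<^sup>1\<close> over \<open>[0, \<pi>/2]\<close>. In polar coordinates
  the volume of the manifold is \<open>c \<integral> f\<^sup>n\<^sup>-\<^sup>1\<close> over \<open>[0,a]\<close>, and that of the sphere is \<open>c \<cdot> 2 W\<close>, where c is the area of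
  the unit sphere of \<open>\<real>\<^sup>n\<close>. The function f is concave, so it increases up to a point \<open>t\<^sub>0\<close>
  and decreases afterwards, and it suffices to show that \<open>\<integral> f\<^sup>n\<^sup>-\<^sup>1 \<le> W\<close> on the increasing part: the other
  part is the increasing part of the manifold read from the other pole
  (\<open>axis_symmetric_manifold_flip\<close>).

  The curvature conditions amount to \<open>f'' \<le> - \<epsilon> f\<close> and
  \<open>n f\<^sup>2 \<le> - 2 f f'' + (n-2) (1 - f'\<^sup>2)\<close>. Let M be the maximum of f, attained at \<open>t\<^sub>0\<close>. Where
  \<open>f' \<ge> 0\<close>, the first condition makes \<open>f'\<^sup>2 + \<epsilon> f\<^sup>2\<close> nonincreasing, and the second one makes the mass
  \<open>m = f\<^sup>n\<^sup>-\<^sup>2 (1 - f'\<^sup>2 - f\<^sup>2)\<close> nondecreasing. As m vanishes at the pole, \<open>M \<le> 1\<close>. Put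
  \<open>f = M sin \<theta>\<close>, \<open>s = sin \<theta>\<close>, \<open>z = 1 / M\<^sup>2 - 1 \<ge> 0\<close> and
  \<open>\<phi> = (s\<^sup>-\<^sup>(\<^sup>n\<^sup>-\<^sup>2\<^sup>) - 1) / (1 - s\<^sup>2)\<close>. Comparing with the values at \<open>t\<^sub>0\<close> gives
  two lower bounds for the speed:
  \<^item> \<open>f'\<^sup>2 \<ge> \<epsilon> M\<^sup>2 cos\<^sup>2 \<theta>\<close>, and
  \<^item> \<open>f'\<^sup>2 \<ge> M\<^sup>2 cos\<^sup>2 \<theta> (1 - z \<phi>)\<close>.

  As \<open>\<phi>\<close> is unbounded near the pole, the second one is of no use there if \<open>z > 0\<close>, but for every \<open>\<theta>\<close> the two
  together imply \<open>M cos \<theta> / f' \<le> 1 + z \<phi> / (2 \<epsilon>)\<close> (\<open>reciprocal_speed_le\<close>). The integral of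
  \<open>M\<^sup>n\<^sup>-\<^sup>1 s\<^sup>n\<^sup>-\<^sup>1 (1 + z \<phi> / (2 \<epsilon>))\<close> over \<open>0 \<le> \<theta> \<le> \<pi>/2\<close> is elementary
  and equals \<open>M\<^sup>n\<^sup>-\<^sup>1 (W + z ((n-1) W - 1) / (2 \<epsilon>))\<close>. The term \<open>- 1\<close> is what the theorem rests on: because of it,
  \<open>\<epsilon> \<ge> 1 - 1 / ((n-1) W)\<close> is enough for the integral to be at most
  \<open>M\<^sup>n\<^sup>-\<^sup>1 W (1 + z (n-1) / 2)\<close>, and Bernoulli's inequality bounds this by
  \<open>M\<^sup>n\<^sup>-\<^sup>1 W (1 + z)\<^bsup>(n-1)/2\<^esup> = W\<close>. This is \<open>integral_power_ascending_le\<close>.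

  The remaining parts connect this estimate with the geometry: the curvature of a warped product at the
  points of a coordinate axis, the regularity of f at the poles, and the two volumes.\<close>


section \<open>Integrals of powers of the sine\<close>

text \<open>The primitive that vanishes at 0, given by the reduction formula. Having it in closed form
  on the whole line yields the values at \<open>\<pi>/2\<close> and \<open>\<pi>\<close> by induction.\<close>

fun sin_power_primitive :: "nat \<Rightarrow> real \<Rightarrow> real" where
  "sin_power_primitive 0 \<theta> = \<theta>"
| "sin_power_primitive (Suc 0) \<theta> = 1 - cos \<theta>"
| "sin_power_primitive (Suc (Suc k)) \<theta> =
     (real (Suc k) * sin_power_primitive k \<theta> - cos \<theta> * sin \<theta> ^ Suc k) / real (Suc (Suc k))"

lemma sin_power_primitive_0: "sin_power_primitive k 0 = 0"
  by (induction k "0::real" rule: sin_power_primitive.induct) auto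

lemma DERIV_power_add_one:
  fixes g :: "real \<Rightarrow> real"
  assumes "(g has_real_derivative D) (at x)"
  shows "((\<lambda>x. g x ^ (k + 1)) has_real_derivative real (k + 1) * (g x ^ k * D)) (at x)"
  using DERIV_power[OF assms, of "k + 1"] by (simp add: mult_ac)

lemma has_real_derivative_sin_power_primitive:
  "(sin_power_primitive k has_real_derivative sin \<theta> ^ k) (at \<theta>)"
proof (induction k \<theta> rule: sin_power_primitive.induct)
  case 1
  then show ?case by simp
next
  case (2 \<theta>)
  have "((\<lambda>\<theta>. 1 - cos \<theta>) has_real_derivative sin \<theta> ^ Suc 0) (at \<theta>)"
    by (auto intro!: derivative_eq_intros)
  then show ?case by simp
next
  case (3 k \<theta>)
  have "((\<lambda>\<theta>. (real (Suc k) * sin_power_primitive k \<theta> - cos \<theta> * sin \<theta> ^ Suc k) / real (Suc (Suc k)))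
     has_real_derivative (real (Suc k) * sin \<theta> ^ k -
        (- sin \<theta> * sin \<theta> ^ Suc k + cos \<theta> * (real (Suc k) * sin \<theta> ^ k * cos \<theta>))) / real (Suc (Suc k))) (at \<theta>)"
    apply (rule DERIV_cdivide)
    apply (rule DERIV_diff)
     apply (rule DERIV_cmult)
     apply (rule 3)
    apply (rule DERIV_cong[OF DERIV_mult[OF DERIV_cos DERIV_power_Suc[OF DERIV_sin]]])
    by (simp add: algebra_simps)
  moreover have "(real (Suc k) * sin \<theta> ^ k -
        (- sin \<theta> * sin \<theta> ^ Suc k + cos \<theta> * (real (Suc k) * sin \<theta> ^ k * cos \<theta>))) / real (Suc (Suc k))
     = sin \<theta> ^ Suc (Suc k)"
  proof -
    have "real (Suc k) * sin \<theta> ^ k -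
        (- sin \<theta> * sin \<theta> ^ Suc k + cos \<theta> * (real (Suc k) * sin \<theta> ^ k * cos \<theta>))
      = sin \<theta> ^ k * (real (Suc k) * (1 - (cos \<theta>)\<^sup>2) + (sin \<theta>)\<^sup>2)"
      by (simp add: algebra_simps power2_eq_square)
    also have "\<dots> = real (Suc (Suc k)) * sin \<theta> ^ Suc (Suc k)"
      unfolding cos_squared_eq by (simp add: algebra_simps power2_eq_square)
    finally show ?thesis by simp
  qed
  ultimately show ?case by simp
qed

lemma continuous_on_sin_power_primitive [continuous_intros]:
  "continuous_on S g \<Longrightarrow> continuous_on S (\<lambda>x. sin_power_primitive k (g x))"
  by (rule continuous_on_compose2[where t=UNIV])
     (auto intro!: continuous_at_imp_continuous_on DERIV_isCont has_real_derivative_sin_power_primitive)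

lemma sin_power_primitive_pi: "sin_power_primitive k pi = 2 * sin_power_primitive k (pi / 2)"
  by (induction k "pi" rule: sin_power_primitive.induct) (auto simp: field_simps)

lemma sin_power_primitive_half_pi_pos: "sin_power_primitive k (pi / 2) > 0"
  by (induction k "pi/2" rule: sin_power_primitive.induct) auto

lemma sin_power_primitive_half_pi_Suc_Suc:
  "real (k + 2) * sin_power_primitive (k + 2) (pi / 2) = real (k + 1) * sin_power_primitive k (pi / 2)"
  by (simp add: field_simps)

text \<open>Bernoulli's inequality for \<open>(p\<^sup>2)\<^bsup>(k+2)/2\<^esup>\<close>, in a form that avoids the possibly half-integral
  exponent. The inequality needs this exponent, which is \<open>(n-1)/2\<close> in the application, to be at least 1.\<close>

lemma bernoulli_square:
  fixes p :: real
  assumes "p \<ge> 1"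
  shows "1 + real (k + 2) / 2 * (p\<^sup>2 - 1) \<le> p ^ (k + 2)"
proof (induction k)
  case 0
  then show ?case by (simp add: power2_eq_square)
next
  case (Suc k)
  have "p ^ 1 \<le> p ^ (k + 2)"
    by (rule power_increasing) (use assms in auto)
  then have "(p + 1) / 2 \<le> p ^ (k + 2)" using assms
    by (rule_tac order_trans[of _ p]) auto
  then have "(p - 1) * ((p + 1) / 2) \<le> (p - 1) * p ^ (k + 2)"
    by (rule mult_left_mono) (use assms in auto)
  with Suc show ?case by (simp add: field_simps power2_eq_square)
qed

text \<open>On \<open>(0, \<pi>/2)\<close> this is \<open>(1 - sin\<^sup>k\<^sup>+\<^sup>1 \<theta>) / cos \<theta> + (k+1) \<integral> sin\<^sup>k\<close>, a primitive of
  \<open>sin\<^sup>k\<^sup>+\<^sup>2 \<theta> \<phi>(\<theta>)\<close> with \<open>\<phi> = (sin\<^sup>-\<^sup>(\<^sup>k\<^sup>+\<^sup>1\<^sup>) \<theta> - 1) / cos\<^sup>2 \<theta>\<close>. It comes from integrating by parts. The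
  quotient is written so that the function is continuous at \<open>\<pi>/2\<close>.\<close>

definition mass_primitive :: "nat \<Rightarrow> real \<Rightarrow> real" where
  "mass_primitive k \<theta> = cos \<theta> / (1 + sin \<theta>) * (\<Sum>j<k+1. sin \<theta> ^ j)
     + real (k + 1) * sin_power_primitive k \<theta>"

lemma mass_primitive_0: "mass_primitive k 0 = 1"
proof -
  have "(\<Sum>j<k+1. (0::real) ^ j) = 1"
    by (induction k) auto
  then show ?thesis by (simp add: mass_primitive_def sin_power_primitive_0)
qed

lemma mass_primitive_half_pi: "mass_primitive k (pi/2) = real (k+2) * sin_power_primitive (k+2) (pi/2)"
  unfolding mass_primitive_def sin_power_primitive_half_pi_Suc_Suc by simp

lemma continuous_on_mass_primitive: "continuous_on {0..pi/2} (mass_primitive k)"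
proof -
  have "1 + sin x \<noteq> 0" if "x \<in> {0..pi/2}" for x
    using sin_ge_zero[of x] that by (auto simp: add_nonneg_eq_0_iff)
  then show ?thesis
    unfolding mass_primitive_def by (auto intro!: continuous_intros)
qed

lemma has_real_derivative_mass_primitive:
  assumes "0 < \<theta>" "\<theta> < pi/2"
  shows "(mass_primitive k has_real_derivative (1 - sin \<theta> ^ (k+1)) * sin \<theta> / (cos \<theta>)\<^sup>2) (at \<theta>)"
proof -
  have eq: "(1 - sin x ^ (k+1)) / cos x + real (k + 1) * sin_power_primitive k x = mass_primitive k x"
    if "x \<in> {0<..<pi/2}" for x
  proof -
    have c: "cos x > 0" and s: "sin x > 0"
      using that by (auto intro!: cos_gt_zero sin_gt_zero)
    have "1 - sin x ^ (k+1) = (1 - sin x) * (\<Sum>j<k+1. sin x ^ j)"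
      by (rule one_diff_power_eq)
    moreover have "(1 - sin x) / cos x = cos x / (1 + sin x)"
      using c s by (simp add: frac_eq_eq cos_squared_eq power2_eq_square[symmetric] algebra_simps)
    ultimately show ?thesis
      unfolding mass_primitive_def by (metis (no_types, lifting) times_divide_eq_left)
  qed
  have c: "cos \<theta> > 0" and s: "sin \<theta> > 0"
    using assms by (auto intro!: cos_gt_zero sin_gt_zero)
  have "((\<lambda>x. (1 - sin x ^ (k+1)) / cos x + real (k + 1) * sin_power_primitive k x)
     has_real_derivative ((0 - real (k+1) * (sin \<theta> ^ k * cos \<theta>)) * cos \<theta> - (1 - sin \<theta> ^ (k+1)) * (- sin \<theta>)) / (cos \<theta> * cos \<theta>) +
      real (k+1) * sin \<theta> ^ k) (at \<theta>)"
    using c by (intro DERIV_add DERIV_divide DERIV_diff DERIV_const DERIV_cmult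
        has_real_derivative_sin_power_primitive DERIV_cos DERIV_power_add_one[OF DERIV_sin]) auto
  moreover have "((0 - real (k+1) * (sin \<theta> ^ k * cos \<theta>)) * cos \<theta> - (1 - sin \<theta> ^ (k+1)) * (- sin \<theta>)) / (cos \<theta> * cos \<theta>) +
      real (k+1) * sin \<theta> ^ k = (1 - sin \<theta> ^ (k+1)) * sin \<theta> / (cos \<theta>)\<^sup>2"
    using c by (simp add: field_simps power2_eq_square)
  ultimately have "((\<lambda>x. (1 - sin x ^ (k+1)) / cos x + real (k + 1) * sin_power_primitive k x)
     has_real_derivative (1 - sin \<theta> ^ (k+1)) * sin \<theta> / (cos \<theta>)\<^sup>2) (at \<theta>)" by simp
  then show ?thesis
    by (rule has_field_derivative_transform_within_open[where S="{0<..<pi/2}"])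
       (use assms eq in auto)
qed

section \<open>The estimate for the warping function\<close>

text \<open>Two bounds on \<open>1 / y\<^sup>2\<close> combine into one: if \<open>y \<ge> 1\<close> then
  \<open>y - 1 = (1 - 1 / y\<^sup>2) \<cdot> y\<^sup>2 / (y + 1) \<le> x \<cdot> y\<^sup>2 / 2\<close>, and the first bound controls the last factor.\<close>

lemma reciprocal_speed_le:
  fixes y x \<epsilon> :: real
  assumes "0 < \<epsilon>" "0 < y" "0 \<le> x" and A: "\<epsilon> * y\<^sup>2 \<le> 1" and B: "y\<^sup>2 * (1 - x) \<le> 1"
  shows "y \<le> 1 + x / (2 * \<epsilon>)"
proof (cases "y \<le> 1")
  case True
  then show ?thesis using assms by (smt (verit) divide_nonneg_pos)
next
  case False
  then have "y - 1 \<le> (y\<^sup>2 - 1) / 2"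
    using zero_le_power2[of "y - 1"] by (simp add: power2_eq_square algebra_simps)
  also have "\<dots> \<le> y\<^sup>2 * x / 2" using B by (simp add: algebra_simps)
  also have "\<dots> = (\<epsilon> * y\<^sup>2) * x / (2 * \<epsilon>)" using assms by simp
  also have "\<dots> \<le> 1 * x / (2 * \<epsilon>)"
    using assms by (intro divide_right_mono mult_right_mono) auto
  finally show ?thesis by simp
qed

text \<open>The estimate on the increasing part of f, in dimension \<open>n = k + 3\<close>. It is obtained by comparing
  \<open>f\<^sup>k\<^sup>+\<^sup>2\<close> with the derivative of an explicit function K of f.\<close>

lemma integral_power_ascending_le:
  fixes f f1 f2 :: "real \<Rightarrow> real" and k :: nat and t0 C \<epsilon> d :: real
  defines "W \<equiv> sin_power_primitive (k + 2) (pi / 2)"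
  assumes t0: "0 < t0" and cont: "continuous_on {0..t0} f" and f0: "f 0 = 0"
    and pos: "\<And>t. 0 < t \<Longrightarrow> t \<le> t0 \<Longrightarrow> f t > 0"
    and df: "\<And>t. 0 < t \<Longrightarrow> t \<le> t0 \<Longrightarrow> (f has_real_derivative f1 t) (at t)"
    and df1: "\<And>t. 0 < t \<Longrightarrow> t \<le> t0 \<Longrightarrow> (f1 has_real_derivative f2 t) (at t)"
    and f1t0: "f1 t0 = 0"
    and bd: "0 < d" "\<And>t. 0 < t \<Longrightarrow> t < d \<Longrightarrow> f t \<le> C * t"
    and eps: "0 < \<epsilon>" "real (k + 2) * W - 1 \<le> \<epsilon> * (real (k + 2) * W)"
    and ric: "\<And>t. 0 < t \<Longrightarrow> t \<le> t0 \<Longrightarrow> f2 t \<le> - \<epsilon> * f t"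
    and scal: "\<And>t. 0 < t \<Longrightarrow> t \<le> t0 \<Longrightarrow>
        real (k + 3) * (f t)\<^sup>2 \<le> - 2 * f t * f2 t + real (k + 1) * (1 - (f1 t)\<^sup>2)"
  shows "integral {0..t0} (\<lambda>t. f t ^ (k + 2)) \<le> W"
proof -
  have f2neg: "f2 t < 0" if "0 < t" "t \<le> t0" for t
  proof -
    have "\<epsilon> * f t > 0" using eps(1) pos[OF that] by simp
    with ric[OF that] show ?thesis by linarith
  qed
  have f1_dec: "f1 t < f1 s" if "0 < s" "s < t" "t \<le> t0" for s t
    by (rule DERIV_neg_imp_decreasing[OF \<open>s < t\<close>]) (use that df1 f2neg in fastforce)
  have f1_pos: "f1 t > 0" if "0 < t" "t < t0" for t
    using f1_dec[of t t0] that f1t0 by auto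
  have f1_nonneg: "f1 t \<ge> 0" if "0 < t" "t \<le> t0" for t
    using f1_pos[of t] that f1t0 by (cases "t = t0") auto
  define M where "M = f t0"
  have M: "M > 0" unfolding M_def using pos t0 by auto
  have f_less: "f t < M" if "0 < t" "t < t0" for t
    unfolding M_def
  proof (rule DERIV_pos_imp_increasing_open[OF \<open>t < t0\<close>])
    show "\<exists>y. (f has_real_derivative y) (at x) \<and> 0 < y" if "t < x" "x < t0" for x
      using df[of x] f1_pos[of x] that \<open>0 < t\<close> by auto
    show "continuous_on {t..t0} f"
      by (rule continuous_on_subset[OF cont]) (use that in auto)
  qed
  have f_le: "f t \<le> M" if "0 \<le> t" "t \<le> t0" for t
    using f_less[of t] that f0 M by (cases "t = 0"; cases "t = t0") (auto simp: M_def)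
  have f_ge: "0 \<le> f t" if "0 \<le> t" "t \<le> t0" for t
    using pos[of t] that f0 by (cases "t = 0") auto

  \<comment> \<open>The Ricci bound makes \<open>f'\<^sup>2 + \<epsilon> f\<^sup>2\<close> nonincreasing.\<close>
  have energy: "\<epsilon> * (M\<^sup>2 - (f t)\<^sup>2) \<le> (f1 t)\<^sup>2" if "0 < t" "t \<le> t0" for t
  proof -
    have "(f1 t0)\<^sup>2 + \<epsilon> * (f t0)\<^sup>2 \<le> (f1 t)\<^sup>2 + \<epsilon> * (f t)\<^sup>2"
    proof (rule DERIV_nonpos_imp_nonincreasing[OF \<open>t \<le> t0\<close>])
      fix x assume x: "t \<le> x" "x \<le> t0"
      then have x': "0 < x" using that by simp
      have "((\<lambda>x. (f1 x)\<^sup>2 + \<epsilon> * (f x)\<^sup>2) has_real_derivative 2 * f1 x * (f2 x + \<epsilon> * f x)) (at x)"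
        using df[OF x' x(2)] df1[OF x' x(2)]
        by (auto intro!: derivative_eq_intros simp: algebra_simps)
      moreover have "2 * f1 x * (f2 x + \<epsilon> * f x) \<le> 0"
        using f1_nonneg[OF x' x(2)] ric[OF x' x(2)] by (intro mult_nonneg_nonpos) auto
      ultimately show "\<exists>y. ((\<lambda>x. (f1 x)\<^sup>2 + \<epsilon> * (f x)\<^sup>2) has_real_derivative y) (at x) \<and> y \<le> 0"
        by blast
    qed
    then show ?thesis using f1t0 by (simp add: M_def algebra_simps)
  qed

  \<comment> \<open>The scalar curvature bound makes the mass nondecreasing; its derivative is that bound
    multiplied by \<open>f\<^sup>k f' \<ge> 0\<close>.\<close>
  define m where "m t = f t ^ (k + 1) * (1 - (f1 t)\<^sup>2 - (f t)\<^sup>2)" for t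
  have m_mono: "m s \<le> m t" if "0 < s" "s \<le> t" "t \<le> t0" for s t
  proof (rule DERIV_nonneg_imp_nondecreasing[OF \<open>s \<le> t\<close>])
    fix x assume x: "s \<le> x" "x \<le> t"
    then have x': "0 < x" "x \<le> t0" using that by auto
    have "(m has_real_derivative (real (k+1) * (f x ^ k * f1 x) * (1 - (f1 x)\<^sup>2 - (f x)\<^sup>2) +
         f x ^ (k + 1) * (- 2 * f1 x * f2 x - 2 * f x * f1 x))) (at x)"
      unfolding m_def
      by (rule DERIV_cong[OF DERIV_mult[OF DERIV_power_add_one[OF df[OF x']]
            DERIV_diff[OF DERIV_diff[OF DERIV_const DERIV_power[OF df1[OF x']]] DERIV_power[OF df[OF x']]]]])
         (simp add: algebra_simps)
    moreover have "real (k+1) * (f x ^ k * f1 x) * (1 - (f1 x)\<^sup>2 - (f x)\<^sup>2) +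
         f x ^ (k + 1) * (- 2 * f1 x * f2 x - 2 * f x * f1 x) =
         f x ^ k * f1 x * (- 2 * f x * f2 x + real (k + 1) * (1 - (f1 x)\<^sup>2) - real (k+3) * (f x)\<^sup>2)"
      by (simp add: algebra_simps power2_eq_square)
    moreover have "f x ^ k * f1 x * (- 2 * f x * f2 x + real (k + 1) * (1 - (f1 x)\<^sup>2) - real (k+3) * (f x)\<^sup>2) \<ge> 0"
      using pos[OF x'] f1_nonneg[OF x'] scal[OF x'] by (intro mult_nonneg_nonneg) auto
    ultimately show "\<exists>y. (m has_real_derivative y) (at x) \<and> 0 \<le> y"
      by auto
  qed
  have m_max: "m t0 = M ^ (k+1) * (1 - M\<^sup>2)"
    by (simp add: m_def M_def f1t0)

  \<comment> \<open>By concavity \<open>f'(t) \<le> f(t) / t\<close>, so that \<open>f'\<close> is bounded near the pole and m tends to 0 there.\<close>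
  have f1_le: "f1 t \<le> C" if t: "0 < t" "t \<le> t0" "t < d" for t
  proof -
    have "\<exists>l z. 0 < z \<and> z < t \<and> (f has_real_derivative l) (at z) \<and> f t - f 0 = (t - 0) * l"
      by (rule MVT) (use t cont df in \<open>force intro: continuous_on_subset simp: real_differentiable_def\<close>)+
    then obtain l z where z: "0 < z" "z < t" "(f has_real_derivative l) (at z)" "f t - f 0 = (t - 0) * l"
      by blast
    have "l = f1 z" using DERIV_unique[OF z(3) df[of z]] z t by simp
    then have "f t = t * f1 z" using z f0 by simp
    moreover have "f1 t < f1 z" using f1_dec[of z t] z t by simp
    ultimately have "t * f1 t < t * C" using bd(2)[of t] t by (smt (verit) mult.commute mult_strict_left_mono)
    then show ?thesis using t by simp
  qed
  have "m t0 \<ge> 0"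
  proof (rule tendsto_upperbound)
    have lim: "(f \<longlongrightarrow> 0) (at_right 0)"
      using continuous_on_Icc_at_rightD[OF cont t0] by (simp add: f0)
    show "((\<lambda>t. - (f t ^ (k + 1) * (C\<^sup>2 + M\<^sup>2))) \<longlongrightarrow> 0) (at_right 0)"
      by (rule tendsto_eq_intros lim refl)+ simp
    have "eventually (\<lambda>t. t \<in> {0<..<min t0 d}) (at_right 0)"
      by (rule eventually_at_right_real) (use t0 bd in auto)
    then show "\<forall>\<^sub>F t in at_right 0. - (f t ^ (k + 1) * (C\<^sup>2 + M\<^sup>2)) \<le> m t0"
    proof eventually_elim
      case (elim t)
      then have t: "0 < t" "t < t0" "t < d" by auto
      have "(f1 t)\<^sup>2 \<le> C\<^sup>2" using f1_le[of t] f1_nonneg[of t] t by (intro power_mono) auto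
      moreover have "(f t)\<^sup>2 \<le> M\<^sup>2" using f_le[of t] f_ge[of t] t by (intro power_mono) auto
      ultimately have "f t ^ (k + 1) * (- (C\<^sup>2 + M\<^sup>2)) \<le> m t"
        unfolding m_def using pos[of t] t by (intro mult_left_mono) auto
      also have "m t \<le> m t0" using m_mono[of t t0] t by simp
      finally show ?case by (simp only: mult_minus_right)
    qed
  qed simp
  then have "1 - M\<^sup>2 \<ge> 0"
    using M by (simp add: m_max zero_le_mult_iff) (smt (verit) mult_pos_pos zero_less_power)
  then have M1: "M \<le> 1"
    using M by (simp add: power_le_one_iff)

  \<comment> \<open>K is the integral of \<open>f\<^sup>k\<^sup>+\<^sup>2\<close> with \<open>dt = df / f'\<close>, where \<open>1 / f'\<close> is replaced by its upper bound
    \<open>(1 + c z \<phi>) / (M cos \<theta>)\<close>.\<close>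
  define z where "z = 1 / M\<^sup>2 - 1"
  have z: "z \<ge> 0" unfolding z_def using M M1 by (simp add: power_le_one)
  define c where "c = 1 / (2 * \<epsilon>)"
  define \<theta> where "\<theta> t = arcsin (f t / M)" for t
  define K where "K t = M ^ (k+2) * (sin_power_primitive (k+2) (\<theta> t) + c * z * mass_primitive k (\<theta> t))" for t
  define K1 where "K1 t = f t ^ (k+2) * (1 + c * z * ((1 - (f t / M)^(k+1)) / ((f t / M) ^ (k+1) * (cos (\<theta> t))\<^sup>2)))
     * (f1 t / (M * cos (\<theta> t)))" for t
  have \<theta>_range: "\<theta> t \<in> {0..pi/2}" if "t \<in> {0..t0}" for t
  proof -
    have "0 \<le> f t / M" "f t / M \<le> 1" using f_le[of t] f_ge[of t] M that by auto
    then show ?thesis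
      unfolding \<theta>_def using arcsin_bounded[of "f t / M"] arcsin_le_arcsin[of 0 "f t / M"] by auto
  qed
  have K_cont: "continuous_on {0..t0} K"
  proof -
    have \<theta>_cont: "continuous_on {0..t0} \<theta>"
      unfolding \<theta>_def
    proof (intro continuous_intros cont ballI conjI)
      fix t assume "t \<in> {0..t0}"
      then have "0 \<le> f t / M" "f t / M \<le> 1" using f_le[of t] f_ge[of t] M by auto
      then show "- 1 \<le> f t / M" "f t / M \<le> 1" by auto
    qed (use M in auto)
    show ?thesis
      unfolding K_def
      by (intro continuous_intros \<theta>_cont continuous_on_compose2[OF continuous_on_mass_primitive])
         (use \<theta>_range in auto)
  qed
  have K_deriv: "(K has_real_derivative K1 t) (at t)" and K1_ge: "f t ^ (k+2) \<le> K1 t"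
    if "t \<in> {0<..<t0}" for t
  proof -
    have t: "0 < t" "t < t0" "t \<le> t0" using that by auto
    define s where "s = f t / M"
    have s: "0 < s" "s < 1" unfolding s_def using pos[of t] f_less[of t] M t by auto
    have sin: "sin (\<theta> t) = s" and cos: "cos (\<theta> t) = sqrt (1 - s\<^sup>2)"
      unfolding \<theta>_def s_def[symmetric] using s by (auto simp: cos_arcsin)
    have s2: "s\<^sup>2 < 1" using s by (simp add: power_less_one_iff)
    have cpos: "cos (\<theta> t) > 0" and c2: "(cos (\<theta> t))\<^sup>2 = 1 - s\<^sup>2" unfolding cos using s2 by auto
    have fs: "f t = M * s" using M by (simp add: s_def)
    have \<theta>t: "0 < \<theta> t" "\<theta> t < pi / 2"
    proof -
      have "\<theta> t \<noteq> 0" using sin s by auto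
      moreover have "\<theta> t \<noteq> pi / 2" using cpos by (metis cos_pi_half less_irrefl)
      ultimately show "0 < \<theta> t" "\<theta> t < pi / 2" using \<theta>_range[of t] t by auto
    qed
    have d\<theta>: "(\<theta> has_real_derivative f1 t / (M * cos (\<theta> t))) (at t)"
    proof -
      have "((\<lambda>t. f t / M) has_real_derivative f1 t / M) (at t)"
        by (rule DERIV_cdivide[OF df]) (use t in auto)
      moreover have "(arcsin has_real_derivative inverse (sqrt (1 - s\<^sup>2))) (at (f t / M))"
        unfolding s_def[symmetric] by (rule DERIV_arcsin) (use s in auto)
      ultimately have "(\<theta> has_real_derivative inverse (sqrt (1 - s\<^sup>2)) * (f1 t / M)) (at t)"
        unfolding \<theta>_def by (rule DERIV_chain2[rotated])
      then show ?thesis by (simp add: cos field_simps)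
    qed
    have "(K has_real_derivative M ^ (k+2) * (s ^ (k+2) * (f1 t / (M * cos (\<theta> t)))
        + c * z * ((1 - s ^ (k+1)) * s / (cos (\<theta> t))\<^sup>2 * (f1 t / (M * cos (\<theta> t)))))) (at t)"
      unfolding K_def
      by (intro DERIV_cmult DERIV_add
          DERIV_chain2[OF has_real_derivative_sin_power_primitive[of _ "\<theta> t", unfolded sin] d\<theta>]
          DERIV_chain2[OF has_real_derivative_mass_primitive[OF \<theta>t, unfolded sin] d\<theta>])
    also have "M ^ (k+2) * (s ^ (k+2) * (f1 t / (M * cos (\<theta> t)))
        + c * z * ((1 - s ^ (k+1)) * s / (cos (\<theta> t))\<^sup>2 * (f1 t / (M * cos (\<theta> t))))) = K1 t"
    proof -
      have "s ^ (k+2) * ((1 - s ^ (k+1)) / (s ^ (k+1) * (cos (\<theta> t))\<^sup>2)) = (1 - s ^ (k+1)) * s / (cos (\<theta> t))\<^sup>2"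
        using s cpos by (simp add: field_simps)
      then have *: "(1 - s ^ (k+1)) * s / (cos (\<theta> t))\<^sup>2 = s ^ (k+2) * ((1 - s ^ (k+1)) / (s ^ (k+1) * (cos (\<theta> t))\<^sup>2))" ..
      have fp: "f t ^ (k+2) = M ^ (k+2) * s ^ (k+2)" by (simp add: fs power_mult_distrib)
      show ?thesis
        unfolding K1_def s_def[symmetric] * fp by (simp only: algebra_simps mult_1_left)
    qed
    finally show "(K has_real_derivative K1 t) (at t)" .

    define y where "y = M * cos (\<theta> t) / f1 t"
    define \<phi> where "\<phi> = (1 - s ^ (k+1)) / (s ^ (k+1) * (cos (\<theta> t))\<^sup>2)"
    have f1: "f1 t > 0" using f1_pos t by auto
    have y: "y > 0" unfolding y_def using M cpos f1 by auto
    have "s ^ (k + 1) \<le> 1" using s by (intro power_le_one) auto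
    then have \<phi>: "\<phi> \<ge> 0" unfolding \<phi>_def using s by auto
    have "y \<le> 1 + z * \<phi> / (2 * \<epsilon>)"
    proof (rule reciprocal_speed_le)
      have y2: "y\<^sup>2 = M\<^sup>2 * (1 - s\<^sup>2) / (f1 t)\<^sup>2"
        by (simp add: y_def power_divide power_mult_distrib c2)
      have "\<epsilon> * (M\<^sup>2 * (1 - s\<^sup>2)) \<le> (f1 t)\<^sup>2"
        using energy[of t] t by (simp add: fs algebra_simps)
      then show "\<epsilon> * y\<^sup>2 \<le> 1" unfolding y2 using f1 by simp
      \<comment> \<open>\<open>m(t) \<le> m(t\<^sub>0)\<close>, solved for \<open>f'\<^sup>2\<close>\<close>
      have "(M * s) ^ (k+1) * (1 - (f1 t)\<^sup>2 - (M * s)\<^sup>2) \<le> M ^ (k+1) * (1 - M\<^sup>2)"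
        using m_mono[of t t0] t by (simp add: m_max m_def[of t] fs)
      then have "M ^ (k+1) * (s ^ (k+1) * (1 - (f1 t)\<^sup>2 - (M * s)\<^sup>2)) \<le> M ^ (k+1) * (1 - M\<^sup>2)"
        by (simp only: power_mult_distrib mult.assoc)
      then have "s ^ (k+1) * (1 - (f1 t)\<^sup>2 - (M * s)\<^sup>2) \<le> 1 - M\<^sup>2"
        using M by (subst (asm) mult_le_cancel_left_pos) auto
      then have "1 - (f1 t)\<^sup>2 - (M * s)\<^sup>2 \<le> (1 - M\<^sup>2) / s ^ (k+1)"
        using s by (simp add: pos_le_divide_eq mult.commute)
      moreover have "M\<^sup>2 * (1 - s\<^sup>2) * (1 - z * \<phi>) = 1 - (M * s)\<^sup>2 - (1 - M\<^sup>2) / s ^ (k+1)"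
      proof -
        have "M\<^sup>2 * z = 1 - M\<^sup>2" using M by (simp add: z_def field_simps)
        moreover have "(1 - s\<^sup>2) * \<phi> = 1 / s ^ (k+1) - 1"
          unfolding \<phi>_def c2 using s s2 by (simp add: field_simps)
        ultimately have "(M\<^sup>2 * z) * ((1 - s\<^sup>2) * \<phi>) = (1 - M\<^sup>2) * (1 / s ^ (k+1) - 1)" by simp
        then show ?thesis by (simp add: algebra_simps)
      qed
      ultimately have "M\<^sup>2 * (1 - s\<^sup>2) * (1 - z * \<phi>) \<le> (f1 t)\<^sup>2" by simp
      then show "y\<^sup>2 * (1 - z * \<phi>) \<le> 1" unfolding y2 using f1 by simp
    qed (use eps y z \<phi> in auto)
    then have "1 \<le> (1 + c * z * \<phi>) / y"
      using y by (simp add: c_def mult.commute)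
    then have "f t ^ (k+2) * 1 \<le> f t ^ (k+2) * ((1 + c * z * \<phi>) / y)"
      using pos[of t] t by (intro mult_left_mono) auto
    also have "\<dots> = K1 t"
      unfolding K1_def s_def[symmetric] \<phi>_def[symmetric] y_def by simp
    finally show "f t ^ (k+2) \<le> K1 t" by simp
  qed

  have K1_int: "(K1 has_integral (K t0 - K 0)) {0..t0}"
    by (rule fundamental_theorem_of_calculus_interior)
       (use t0 K_cont K_deriv in \<open>auto simp: has_real_derivative_iff_has_vector_derivative\<close>)
  have "integral {0..t0} (\<lambda>t. f t ^ (k+2)) \<le> K t0 - K 0"
  proof (rule has_integral_le)
    have "((\<lambda>t. f t ^ (k+2)) has_integral integral {0..t0} (\<lambda>t. f t ^ (k+2))) {0..t0}"
      by (intro integrable_integral integrable_continuous_real continuous_intros cont)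
    then show "((\<lambda>t. f t ^ (k+2)) has_integral integral {0..t0} (\<lambda>t. f t ^ (k+2))) {0<..<t0}"
      by (simp add: has_integral_Icc_iff_Ioo)
    show "(K1 has_integral (K t0 - K 0)) {0<..<t0}"
      using K1_int by (simp add: has_integral_Icc_iff_Ioo)
  qed (rule K1_ge)
  also have "K t0 - K 0 = M ^ (k+2) * (W + c * (z * (real (k+2) * W - 1)))"
    using M by (simp add: K_def \<theta>_def f0 M_def[symmetric] mass_primitive_0 mass_primitive_half_pi
        sin_power_primitive_0 W_def algebra_simps del: sin_power_primitive.simps)
  also have "\<dots> \<le> M ^ (k+2) * (W * (1 / M) ^ (k+2))"
  proof (rule mult_left_mono)
    have "c * (z * (real (k+2) * W - 1)) \<le> c * (z * (\<epsilon> * (real (k+2) * W)))"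
      using eps z by (intro mult_left_mono) (auto simp: c_def)
    also have "\<dots> = W * (real (k+2) / 2 * ((1 / M)\<^sup>2 - 1))"
      using eps by (simp add: c_def z_def power_divide)
    finally have "W + c * (z * (real (k+2) * W - 1)) \<le> W * (1 + real (k+2) / 2 * ((1 / M)\<^sup>2 - 1))"
      by (simp only: distrib_left)
    also have "\<dots> \<le> W * (1 / M) ^ (k+2)"
    proof (rule mult_left_mono[OF bernoulli_square])
      show "0 \<le> W" unfolding W_def using sin_power_primitive_half_pi_pos less_imp_le by blast
    qed (use M M1 in auto)
    finally show "W + c * (z * (real (k+2) * W - 1)) \<le> W * (1 / M) ^ (k+2)" .
  qed (use M in auto)
  also have "\<dots> = W" using M by (simp add: power_one_over)
  finally show ?thesis .
qed

section \<open>Radial tensors\<close>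

abbreviation kd :: "'n \<Rightarrow> 'n \<Rightarrow> real" where
  "kd i j \<equiv> if i = j then 1 else 0"

lemma sum_kd [simp]:
  "(\<Sum>l\<in>UNIV. kd k l * F l) = F (k::'n::finite)"
proof -
  have "(\<Sum>l\<in>UNIV. kd k l * F l) = (\<Sum>l\<in>UNIV. if k = l then F l else 0)"
    by (rule sum.cong) auto
  also have "\<dots> = F k" by (simp only: sum.delta' finite iso_tuple_UNIV_I if_True)
  finally show ?thesis .
qed

lemma sum_eq_single:
  fixes F :: "'n::finite \<Rightarrow> real"
  assumes "\<And>m. m \<noteq> i \<Longrightarrow> F m = 0"
  shows "(\<Sum>m\<in>UNIV. F m) = F i"
proof -
  have "sum F UNIV = sum F {i}"
    by (rule sum.mono_neutral_right) (use assms in auto)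
  then show ?thesis by simp
qed

lemma matrix_inv_eq:
  fixes A B :: "real^'n^'n"
  assumes "A ** B = mat 1"
  shows "matrix_inv A = B"
proof -
  have BA: "B ** A = mat 1" using assms matrix_left_right_inverse by blast
  then have "A ** matrix_inv A = mat 1 \<and> matrix_inv A ** A = mat 1"
    unfolding matrix_inv_def using assms
    by - (rule someI[where P="\<lambda>X. A ** X = mat 1 \<and> X ** A = mat 1" and x=B], rule conjI)
  then have "matrix_inv A ** (A ** B) = B"
    by (simp only: matrix_mul_assoc matrix_mul_lid)
  then show ?thesis by (simp only: assms matrix_mul_rid)
qed

lemma partial_eq: "(F has_derivative D) (at x) \<Longrightarrow> partial i F x = D (axis i 1)"
  unfolding partial_def by (drule frechet_derivative_at) (erule subst, rule refl)

lemma partial_eq_transform: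
  assumes "(F has_derivative D) (at x)" "open U" "x \<in> U" "\<And>y. y \<in> U \<Longrightarrow> F y = G y"
  shows "partial i G x = D (axis i 1)"
  using has_derivative_transform_within_open[OF assms] by (rule partial_eq)

lemma has_derivative_norm':
  fixes x :: "'a::real_inner"
  shows "x \<noteq> 0 \<Longrightarrow> (norm has_derivative (\<lambda>h. (x \<bullet> h) / norm x)) (at x)"
  using has_derivative_norm[of x] by (simp add: sgn_div_norm inner_commute[of x] divide_inverse_commute)

lemma has_derivative_radial:
  fixes x :: "'a::real_inner"
  assumes "x \<noteq> 0" "(u has_real_derivative u') (at (norm x))"
  shows "((\<lambda>y. u (norm y)) has_derivative (\<lambda>h. u' / norm x * (x \<bullet> h))) (at x)"
proof -
  have "(u has_derivative (*) u') (at (norm x))"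
    using assms(2) by (simp add: has_field_derivative_def)
  from has_derivative_compose[OF has_derivative_norm'[OF assms(1)] this] show ?thesis by simp
qed

lemma partial_norm:
  fixes x :: "real^'n"
  shows "x \<noteq> 0 \<Longrightarrow> partial i norm x = x $ i / norm x"
  by (subst partial_eq[OF has_derivative_norm']) (auto simp: inner_axis)

lemma partial_sgn:
  fixes x :: "real^'n"
  assumes "x \<noteq> 0"
  shows "partial i sgn x = (1 / norm x) *\<^sub>R axis i 1 - (x $ i / norm x ^ 3) *\<^sub>R x"
proof -
  have "((\<lambda>y. inverse (norm y)) has_derivative (\<lambda>h. (- inverse ((norm x)\<^sup>2)) / norm x * (x \<bullet> h))) (at x)"
    by (rule has_derivative_radial[OF assms])
       (use assms in \<open>auto intro!: derivative_eq_intros simp: power2_eq_square\<close>)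
  then have "((\<lambda>y. inverse (norm y) *\<^sub>R y) has_derivative
     (\<lambda>h. inverse (norm x) *\<^sub>R h + ((- inverse ((norm x)\<^sup>2)) / norm x * (x \<bullet> h)) *\<^sub>R x)) (at x)"
    by (rule has_derivative_scaleR) (rule has_derivative_ident)
  then have "(sgn has_derivative
     (\<lambda>h. inverse (norm x) *\<^sub>R h + ((- inverse ((norm x)\<^sup>2)) / norm x * (x \<bullet> h)) *\<^sub>R x)) (at x)"
    by (rule has_derivative_transform_within_open[OF _ open_UNIV]) (auto simp: sgn_div_norm)
  from partial_eq[OF this] show ?thesis
    by (simp add: inner_axis inverse_eq_divide power3_eq_cube power2_eq_square field_simps)
qed

lemma norm_power2_sum: "(norm x)\<^sup>2 = (\<Sum>i\<in>UNIV. x $ i * x $ i)" for x :: "real^'n"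
  by (simp add: power2_norm_eq_inner inner_vec_def)

lemma warped_metric_radial:
  fixes x :: "real^'n"
  assumes "x \<noteq> 0"
  shows "warped_metric f norm sgn x $ i $ j =
    (f (norm x))\<^sup>2 / (norm x)\<^sup>2 * kd i j + (1 - (f (norm x))\<^sup>2 / (norm x)\<^sup>2) / (norm x)\<^sup>2 * (x $ i * x $ j)"
proof -
  define r where "r = norm x"
  have r: "r \<noteq> 0" and xx: "x \<bullet> x = r * r" using assms by (auto simp: r_def dot_square_norm power2_eq_square)
  have ax: "axis i 1 \<bullet> axis j (1::real) = kd i j" "axis i 1 \<bullet> x = x $ i" "x \<bullet> axis j 1 = x $ j"
    by (simp add: inner_axis, simp add: axis_def, simp_all add: inner_axis inner_axis')
  have *: "partial i sgn x \<bullet> partial j sgn x = kd i j / r\<^sup>2 - x $ i * x $ j / r ^ 4"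
    unfolding partial_sgn[OF assms] r_def[symmetric]
    using r by (simp add: inner_diff_left inner_diff_right ax xx
       power2_eq_square power3_eq_cube power4_eq_xxxx field_simps)
  show ?thesis
    unfolding warped_metric_def induced_metric_def
    using r by (simp only: vector_add_component vector_scaleR_component vec_lambda_beta *
        partial_norm[OF assms] r_def[symmetric] inner_real_def)
      (simp add: field_simps power4_eq_xxxx power2_eq_square)
qed

text \<open>An orthogonal change of basis that takes x to a multiple of a coordinate vector makes the
  matrix diagonal, with entries u except for one entry \<open>u + v |x|\<^sup>2\<close>.\<close>

lemma det_rank_one_update:
  fixes x :: "real^'n"
  assumes "x \<noteq> 0" and G: "\<And>i j. G $ i $ j = u * kd i j + v * (x $ i * x $ j)"
  shows "det G = u ^ (CARD('n) - 1) * (u + v * (norm x)\<^sup>2)"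
proof -
  fix p :: 'n
  define r where "r = norm x"
  have r: "r \<noteq> 0" using assms by (simp add: r_def)
  obtain R :: "real^'n^'n" where R: "orthogonal_matrix R" and Rp: "R *v axis p 1 = (1 / r) *\<^sub>R x"
    using orthogonal_matrix_exists_basis[of "(1/r) *\<^sub>R x" p] r by (auto simp: r_def)
  have RR: "transpose R ** R = mat 1" "R ** transpose R = mat 1"
    using R by (auto simp: orthogonal_matrix_def)
  have col: "x $ i = r * R $ i $ p" for i
    using arg_cong[OF Rp, of "\<lambda>v. v $ i"] r by (simp add: matrix_vector_mult_basis column_def)
  define D :: "real^'n^'n" where "D = (\<chi> i j. u * kd i j + v * r\<^sup>2 * (kd i p * kd j p))"
  have "G = R ** D ** transpose R"
  proof -
    have 1: "(R ** D) $ i $ j = u * R $ i $ j + v * r\<^sup>2 * R $ i $ p * kd p j" for i j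
    proof -
      have "(R ** D) $ i $ j = (\<Sum>k\<in>UNIV. kd j k * (u * R $ i $ k)) + (\<Sum>k\<in>UNIV. kd p k * (v * r\<^sup>2 * R $ i $ k * kd p j))"
        unfolding matrix_matrix_mult_def D_def sum.distrib[symmetric] vec_lambda_beta
        by (intro sum.cong refl) (auto simp: algebra_simps)
      then show ?thesis by (simp only: sum_kd)
    qed
    have 2: "(R ** D ** transpose R) $ i $ j = u * kd i j + v * r\<^sup>2 * R $ i $ p * R $ j $ p" for i j
    proof -
      have "(R ** D ** transpose R) $ i $ j =
          u * (R ** transpose R) $ i $ j + (\<Sum>k\<in>UNIV. kd p k * (v * r\<^sup>2 * R $ i $ p * R $ j $ k))"
        unfolding matrix_matrix_mult_def[of _ "transpose R"]
        by (simp add: 1 transpose_def algebra_simps sum.distrib sum_distrib_left)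
      then show ?thesis by (simp only: sum_kd RR mat_def vec_lambda_beta)
    qed
    show ?thesis by (simp add: vec_eq_iff 2 G col power2_eq_square)
  qed
  then have "det G = det (R ** transpose R) * det D"
    by (simp add: det_mul)
  also have "\<dots> = det D" by (simp add: RR)
  also have "\<dots> = (\<Prod>i\<in>UNIV. D $ i $ i)"
    by (rule det_diagonal) (auto simp: D_def)
  also have "\<dots> = D $ p $ p * (\<Prod>i\<in>UNIV - {p}. D $ i $ i)"
    using prod.remove[of UNIV p "\<lambda>i. D $ i $ i"] by simp
  also have "(\<Prod>i\<in>UNIV - {p}. D $ i $ i) = (\<Prod>i\<in>UNIV - {p}. u)"
    by (rule prod.cong) (auto simp: D_def)
  also have "\<dots> = u ^ (CARD('n) - 1)" by simp
  finally show ?thesis by (simp add: D_def r_def mult.commute)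
qed


lemma has_derivative_component: "((\<lambda>y. y $ i) has_derivative (\<lambda>h. h $ i)) (at (x :: real^'n))"
  by (rule bounded_linear_imp_has_derivative) (rule bounded_linear_vec_nth)

lemma partial_radial_metric:
  fixes x :: "real^'n"
  assumes "x \<noteq> 0"
    and u: "(u has_real_derivative u') (at (norm x))" and v: "(v has_real_derivative v') (at (norm x))"
    and "open U" "x \<in> U" and G: "\<And>y. y \<in> U \<Longrightarrow> G y = u (norm y) * kd i j + v (norm y) * (y $ i * y $ j)"
  shows "partial m G x = u' / norm x * x $ m * kd i j + v' / norm x * x $ m * x $ i * x $ j
     + v (norm x) * (kd i m * x $ j + kd j m * x $ i)"
proof -
  have "((\<lambda>y. u (norm y) * kd i j + v (norm y) * (y $ i * y $ j)) has_derivative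
     (\<lambda>h. (u' / norm x * (x \<bullet> h)) * kd i j + (v (norm x) * (x $ i * h $ j + h $ i * x $ j)
        + v' / norm x * (x \<bullet> h) * (x $ i * x $ j)))) (at x)"
    by (intro has_derivative_add has_derivative_mult has_derivative_mult_left has_derivative_radial assms
        has_derivative_component)
  from partial_eq_transform[OF this \<open>open U\<close> \<open>x \<in> U\<close>, of G m] G
  have *: "partial m G x = (u' / norm x * (x \<bullet> axis m 1)) * kd i j + (v (norm x) * (x $ i * axis m 1 $ j + axis m 1 $ i * x $ j)
        + v' / norm x * (x \<bullet> axis m 1) * (x $ i * x $ j))"
    by simp
  have ax: "axis m 1 $ l = kd l m" for l :: 'n by (simp add: axis_def)
  have xm: "x \<bullet> axis m 1 = x $ m" by (simp add: inner_axis)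
  show ?thesis unfolding * ax xm by (simp only: algebra_simps times_divide_eq_left times_divide_eq_right)
qed

text \<open>The general form of the Christoffel symbols of a rotationally invariant metric.\<close>

definition radial_symbol :: "(real \<Rightarrow> real) \<Rightarrow> (real \<Rightarrow> real) \<Rightarrow> (real \<Rightarrow> real) \<Rightarrow> 'n \<Rightarrow> 'n \<Rightarrow> 'n \<Rightarrow> real^'n \<Rightarrow> real" where
  "radial_symbol \<alpha> \<beta> \<gamma> k i j x = \<alpha> (norm x) * (x $ i * kd j k + x $ j * kd i k)
     + \<beta> (norm x) * (x $ k * kd i j) + \<gamma> (norm x) * (x $ i * (x $ j * x $ k))"

lemma partial_radial_symbol:
  fixes x :: "real^'n"
  assumes "x \<noteq> 0"
    and d: "(\<alpha> has_real_derivative \<alpha>') (at (norm x))" "(\<beta> has_real_derivative \<beta>') (at (norm x))"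
      "(\<gamma> has_real_derivative \<gamma>') (at (norm x))"
    and "open U" "x \<in> U" and G: "\<And>y. y \<in> U \<Longrightarrow> G y = radial_symbol \<alpha> \<beta> \<gamma> k i j y"
  shows "partial m G x = x $ m / norm x * (\<alpha>' * (x $ i * kd j k + x $ j * kd i k)
     + \<beta>' * (x $ k * kd i j) + \<gamma>' * (x $ i * (x $ j * x $ k)))
     + \<alpha> (norm x) * (kd i m * kd j k + kd j m * kd i k) + \<beta> (norm x) * (kd k m * kd i j)
     + \<gamma> (norm x) * (kd i m * x $ j * x $ k + x $ i * kd j m * x $ k + x $ i * x $ j * kd k m)"
proof -
  have "((\<lambda>y. \<alpha> (norm y) * (y $ i * kd j k + y $ j * kd i k)
     + \<beta> (norm y) * (y $ k * kd i j) + \<gamma> (norm y) * (y $ i * (y $ j * y $ k))) has_derivative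
     (\<lambda>h. \<alpha> (norm x) * (h $ i * kd j k + h $ j * kd i k) + \<alpha>' / norm x * (x \<bullet> h) * (x $ i * kd j k + x $ j * kd i k)
       + (\<beta> (norm x) * (h $ k * kd i j) + \<beta>' / norm x * (x \<bullet> h) * (x $ k * kd i j))
       + (\<gamma> (norm x) * (x $ i * (x $ j * h $ k + h $ j * x $ k) + h $ i * (x $ j * x $ k))
         + \<gamma>' / norm x * (x \<bullet> h) * (x $ i * (x $ j * x $ k))))) (at x)"
    by (intro has_derivative_add has_derivative_mult has_derivative_mult_left has_derivative_radial assms
        has_derivative_component)
  from partial_eq_transform[OF this \<open>open U\<close> \<open>x \<in> U\<close>, of G m] G
  have *: "partial m G x = \<alpha> (norm x) * (axis m 1 $ i * kd j k + axis m 1 $ j * kd i k) + \<alpha>' / norm x * (x \<bullet> axis m 1) * (x $ i * kd j k + x $ j * kd i k)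
       + (\<beta> (norm x) * (axis m 1 $ k * kd i j) + \<beta>' / norm x * (x \<bullet> axis m 1) * (x $ k * kd i j))
       + (\<gamma> (norm x) * (x $ i * (x $ j * axis m 1 $ k + axis m 1 $ j * x $ k) + axis m 1 $ i * (x $ j * x $ k))
         + \<gamma>' / norm x * (x \<bullet> axis m 1) * (x $ i * (x $ j * x $ k)))"
    by (simp only: radial_symbol_def)
  have ax: "axis m 1 $ l = kd l m" for l :: 'n by (simp add: axis_def)
  have xm: "x \<bullet> axis m 1 = x $ m" by (simp add: inner_axis)
  show ?thesis unfolding * ax xm by (simp only: algebra_simps times_divide_eq_left times_divide_eq_right)
qed

section \<open>Curvature of a warped product\<close>

text \<open>In the chart the metric is \<open>A(r) \<delta>\<^sub>i\<^sub>j + B(r) x\<^sub>i x\<^sub>j\<close> with \<open>r = |x|\<close> and \<open>A + B r\<^sup>2 = 1\<close>. Its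
  Christoffel symbols have the coefficients \<open>\<alpha>\<close>, \<open>\<beta>\<close>, \<open>\<gamma>\<close> below; the relation between them says that the
  rays from the origin are geodesics parametrized by arc length. A prime marks the derivative. By
  rotational symmetry it is enough to know the curvature at the points of one coordinate axis, where
  few Christoffel symbols are nonzero.\<close>

context
  fixes a :: real and f f1 f2 :: "real \<Rightarrow> real" and g :: "real^'n \<Rightarrow> real^'n^'n"
  assumes df: "\<And>t. t \<in> {0<..<a} \<Longrightarrow> (f has_real_derivative f1 t) (at t)"
    and df1: "\<And>t. t \<in> {0<..<a} \<Longrightarrow> (f1 has_real_derivative f2 t) (at t)"
    and f_pos: "\<And>t. t \<in> {0<..<a} \<Longrightarrow> f t > 0"
    and g: "\<And>x. x \<in> ball 0 a - {0} \<Longrightarrow> g x = warped_metric f norm sgn x"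
begin

private definition A where "A t = (f t)\<^sup>2 / t\<^sup>2"
private definition A' where "A' t = 2 * f t * f1 t / t\<^sup>2 - 2 * (f t)\<^sup>2 / t ^ 3"
private definition B where "B t = (1 - A t) / t\<^sup>2"
private definition B' where "B' t = - A' t / t\<^sup>2 - 2 * (1 - A t) / t ^ 3"
private definition \<alpha> where "\<alpha> t = (f1 t / f t - 1 / t) / t"
private definition \<alpha>' where "\<alpha>' t = (f2 t / f t - (f1 t)\<^sup>2 / (f t)\<^sup>2 + 1 / t\<^sup>2) / t - (f1 t / f t - 1 / t) / t\<^sup>2"
private definition \<beta> where "\<beta> t = 1 / t\<^sup>2 - f t * f1 t / t ^ 3"
private definition \<beta>' where "\<beta>' t = - 2 / t ^ 3 - ((f1 t)\<^sup>2 + f t * f2 t) / t ^ 3 + 3 * f t * f1 t / t ^ 4"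
private definition \<gamma> where "\<gamma> t = - (2 * \<alpha> t + \<beta> t) / t\<^sup>2"
private definition \<gamma>' where "\<gamma>' t = - (2 * \<alpha>' t + \<beta>' t) / t\<^sup>2 + 2 * (2 * \<alpha> t + \<beta> t) / t ^ 3"

private lemma derivs:
  assumes t: "t \<in> {0<..<a}"
  shows "(A has_real_derivative A' t) (at t)" "(B has_real_derivative B' t) (at t)"
    "(\<alpha> has_real_derivative \<alpha>' t) (at t)" "(\<beta> has_real_derivative \<beta>' t) (at t)"
    "(\<gamma> has_real_derivative \<gamma>' t) (at t)"
proof -
  note d = df[OF t] df1[OF t]
  have t0: "t \<noteq> 0" and f0: "f t \<noteq> 0" using t f_pos[OF t] by auto
  show A: "(A has_real_derivative A' t) (at t)"
    unfolding A_def A'_def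
    by (rule derivative_eq_intros d refl | use t0 in \<open>simp add: field_simps power2_eq_square power3_eq_cube\<close>)+
  show "(B has_real_derivative B' t) (at t)"
    unfolding B_def[abs_def] B'_def
    by (rule derivative_eq_intros A refl | use t0 in \<open>simp add: field_simps power2_eq_square power3_eq_cube\<close>)+
  show \<alpha>: "(\<alpha> has_real_derivative \<alpha>' t) (at t)"
    unfolding \<alpha>_def[abs_def] \<alpha>'_def
    by (rule derivative_eq_intros d refl | use t0 f0 in \<open>simp add: field_simps power2_eq_square power3_eq_cube\<close>)+
  show \<beta>: "(\<beta> has_real_derivative \<beta>' t) (at t)"
    unfolding \<beta>_def[abs_def] \<beta>'_def
    by (rule derivative_eq_intros d refl | use t0 in \<open>simp add: field_simps power2_eq_square power3_eq_cube power4_eq_xxxx\<close>)+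
  show "(\<gamma> has_real_derivative \<gamma>' t) (at t)"
    unfolding \<gamma>_def[abs_def] \<gamma>'_def
    by (rule derivative_eq_intros \<alpha> \<beta> refl | use t0 in \<open>simp add: field_simps power2_eq_square power3_eq_cube\<close>)+
qed

private lemma U: "open (ball 0 a - {0::real^'n})" by (simp add: open_Diff)

private lemma g_eq: "y \<in> ball 0 a - {0} \<Longrightarrow> g y $ i $ j = A (norm y) * kd i j + B (norm y) * (y $ i * y $ j)"
  using warped_metric_radial[of y f i j] by (simp add: g A_def B_def)

private lemma matrix_inv_g:
  assumes x: "x \<in> ball 0 a - {0}"
  shows "matrix_inv (g x) $ k $ l = 1 / A (norm x) * kd k l + (1 - 1 / A (norm x)) / (norm x)\<^sup>2 * (x $ k * x $ l)"
proof -
  define r where "r = norm x"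
  have r: "r \<in> {0<..<a}" using x by (auto simp: r_def)
  have r0: "r \<noteq> 0" and Apos: "A r > 0" using r f_pos[OF r] by (auto simp: A_def)
  define s t where "s = 1 / A r" and "t = (1 - 1 / A r) / r\<^sup>2"
  define H :: "real^'n^'n" where "H = (\<chi> k l. s * kd k l + t * (x $ k * x $ l))"
  have "g x ** H = mat 1"
  proof (simp only: vec_eq_iff, intro allI)
    fix i j
    have "(g x ** H) $ i $ j = (\<Sum>l\<in>UNIV. (A r * kd i l + B r * (x $ i * x $ l)) * (s * kd l j + t * (x $ l * x $ j)))"
      by (simp only: matrix_matrix_mult_def vec_lambda_beta g_eq[OF x] H_def r_def)
    also have "\<dots> = (\<Sum>l\<in>UNIV. kd i l * (A r * (s * kd l j + t * (x $ l * x $ j))))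
       + (\<Sum>l\<in>UNIV. kd j l * (B r * x $ i * x $ l * s))
       + B r * x $ i * x $ j * t * (\<Sum>l\<in>UNIV. x $ l * x $ l)"
      unfolding sum_distrib_left sum.distrib[symmetric]
      by (intro sum.cong refl) (simp add: algebra_simps)
    also have "\<dots> = (A r * s) * kd i j + x $ i * x $ j * (A r * t + B r * s + B r * (t * r\<^sup>2))"
      unfolding sum_kd norm_power2_sum[symmetric] r_def[symmetric]
      by (simp only: algebra_simps)
    also have "A r * t + B r * s + B r * (t * r\<^sup>2) = 0"
      using r0 Apos by (simp add: B_def s_def t_def field_simps)
    also have "A r * s = 1" using Apos by (simp add: s_def)
    finally show "(g x ** H) $ i $ j = mat 1 $ i $ j" by (simp add: mat_def)
  qed
  then have "matrix_inv (g x) = H" by (rule matrix_inv_eq)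
  then show ?thesis by (simp add: H_def r_def s_def t_def)
qed

private lemma christoffel_eq:
  assumes x: "x \<in> ball 0 a - {0}"
  shows "christoffel g k i j x = radial_symbol \<alpha> \<beta> \<gamma> k i j x"
proof -
  define r where "r = norm x"
  have r: "r \<in> {0<..<a}" using x by (auto simp: r_def)
  have r0: "r \<noteq> 0" and f0: "f r \<noteq> 0" and A0: "A r \<noteq> 0" using r f_pos[OF r] by (auto simp: A_def)
  have D: "partial m (\<lambda>y. g y $ i $ j) x = A' r / r * x $ m * kd i j + B' r / r * x $ m * x $ i * x $ j
     + B r * (kd i m * x $ j + kd j m * x $ i)" for m i j
    unfolding r_def
    by (rule partial_radial_metric[OF _ _ _ U x g_eq]) (use x r in \<open>auto simp: r_def[symmetric] intro: derivs\<close>)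
  define P Q s t where "P = A' r / (2 * r)" and "Q = B' r / (2 * r)"
    and "s = 1 / A r" and "t = (1 - 1 / A r) / r\<^sup>2"
  define N where "N = (B r - P) * kd i j + Q * (x $ i * x $ j)"
  have PQ: "A' r / r = 2 * P" "B' r / r = 2 * Q" by (simp_all add: P_def Q_def)
  have E: "partial i (\<lambda>y. g y $ j $ l) x + partial j (\<lambda>y. g y $ i $ l) x - partial l (\<lambda>y. g y $ i $ j) x
     = 2 * (P * x $ i * kd j l + P * x $ j * kd i l + N * x $ l)" for l
    unfolding D PQ N_def by (auto simp: algebra_simps)
  have "christoffel g k i j x = (\<Sum>l\<in>UNIV. (s * kd k l + t * (x $ k * x $ l)) *
          (P * x $ i * kd j l + P * x $ j * kd i l + N * x $ l))"
    unfolding christoffel_def E matrix_inv_g[OF x] r_def[symmetric] t_def[symmetric]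
    unfolding s_def[symmetric] sum_distrib_left by (intro sum.cong refl) simp
  also have "\<dots> = (\<Sum>l\<in>UNIV. kd k l * (s * (P * x $ i * kd j l + P * x $ j * kd i l + N * x $ l)))
     + (\<Sum>l\<in>UNIV. kd j l * (t * x $ k * x $ l * (P * x $ i)))
     + (\<Sum>l\<in>UNIV. kd i l * (t * x $ k * x $ l * (P * x $ j)))
     + t * x $ k * N * (\<Sum>l\<in>UNIV. x $ l * x $ l)"
      unfolding sum_distrib_left sum.distrib[symmetric]
      by (intro sum.cong refl) (simp add: algebra_simps)
  also have "\<dots> = s * P * (x $ i * kd j k + x $ j * kd i k) + (s + t * r\<^sup>2) * N * x $ k + 2 * t * P * x $ i * x $ j * x $ k"
    unfolding sum_kd norm_power2_sum[symmetric] r_def[symmetric] by (simp only: algebra_simps)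
  also have "s * P = \<alpha> r"
    using r0 f0 by (simp add: s_def P_def \<alpha>_def A_def A'_def field_simps power2_eq_square power3_eq_cube)
  also have "s + t * r\<^sup>2 = 1" using r0 by (simp add: s_def t_def)
  also have "\<alpha> r * (x $ i * kd j k + x $ j * kd i k) + 1 * N * x $ k + 2 * t * P * x $ i * x $ j * x $ k
     = \<alpha> r * (x $ i * kd j k + x $ j * kd i k) + (B r - P) * (x $ k * kd i j) + (2 * t * P + Q) * (x $ i * (x $ j * x $ k))"
    unfolding N_def by (simp only: algebra_simps mult_1_left)
  also have "B r - P = \<beta> r"
    using r0 by (simp add: B_def P_def \<beta>_def A_def A'_def field_simps power2_eq_square power3_eq_cube)
  also have "2 * t * P + Q = \<gamma> r"
    using r0 f0 by (simp add: t_def P_def Q_def \<gamma>_def \<alpha>_def \<beta>_def A_def A'_def B'_def field_simps power2_eq_square power3_eq_cube)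
  finally show ?thesis by (simp add: radial_symbol_def r_def)
qed

private lemma partial_christoffel:
  assumes x: "x \<in> ball 0 a - {0}"
  defines "r \<equiv> norm x"
  shows "partial m (christoffel g k i j) x = x $ m / r * (\<alpha>' r * (x $ i * kd j k + x $ j * kd i k)
     + \<beta>' r * (x $ k * kd i j) + \<gamma>' r * (x $ i * (x $ j * x $ k)))
     + \<alpha> r * (kd i m * kd j k + kd j m * kd i k) + \<beta> r * (kd k m * kd i j)
     + \<gamma> r * (kd i m * x $ j * x $ k + x $ i * kd j m * x $ k + x $ i * x $ j * kd k m)"
  unfolding r_def
  by (rule partial_radial_symbol[OF _ _ _ _ U x christoffel_eq]) (use x in \<open>auto intro: derivs\<close>)

context
  fixes t :: real and p :: 'n
  assumes t: "t \<in> {0<..<a}"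
begin

private lemma xp: "axis p t \<in> ball 0 a - {0::real^'n}" "norm (axis p t) = t" "axis p t $ i = t * kd i p"
  using t by (auto simp: norm_eq_sqrt_inner inner_axis_axis dist_norm) (auto simp: axis_def)

private lemma christoffel_at:
  "christoffel g k i j (axis p t) = \<alpha> t * t * (kd i p * kd j k + kd j p * kd i k) + \<beta> t * t * (kd k p * kd i j)
     + \<gamma> t * t ^ 3 * (kd i p * kd j p * kd k p)"
  unfolding christoffel_eq[OF xp(1)] radial_symbol_def xp(2,3) by (simp add: power3_eq_cube)

private lemma gamma_t: "\<gamma> t * t\<^sup>2 = - 2 * \<alpha> t - \<beta> t"
  using t by (simp add: \<gamma>_def)

text \<open>The components that give the sectional curvatures: \<open>- f'' / f\<close> for planes containing the radial
  direction and \<open>(1 - f'\<^sup>2) / f\<^sup>2\<close> for the others. The factor \<open>f\<^sup>2 / t\<^sup>2\<close> in the last two components is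
  the squared length of a coordinate vector tangent to the spheres.\<close>

private lemma riemann_values:
  shows "riemann g i i i i (axis p t) = 0"
    and "i \<noteq> p \<Longrightarrow> riemann g i p i p (axis p t) = - f2 t / f t"
    and "k \<noteq> p \<Longrightarrow> riemann g p k p k (axis p t) = - f t * f2 t / t\<^sup>2"
    and "i \<noteq> p \<Longrightarrow> k \<noteq> p \<Longrightarrow> i \<noteq> k \<Longrightarrow> riemann g i k i k (axis p t) = (1 - (f1 t)\<^sup>2) / t\<^sup>2"
proof -
  have t0: "t \<noteq> 0" and f0: "f t \<noteq> 0" using t f_pos[OF t] by auto
  note pc = partial_christoffel[OF xp(1), unfolded xp(2,3)]
  have G: "\<gamma> t * t ^ 3 = - 2 * \<alpha> t * t - \<beta> t * t"
    using arg_cong[OF gamma_t, of "\<lambda>c. c * t"] by (simp add: power3_eq_cube power2_eq_square left_diff_distrib)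
  show "riemann g i i i i (axis p t) = 0" by (simp add: riemann_def)
  show "riemann g i p i p (axis p t) = - f2 t / f t" if ip: "i \<noteq> p"
  proof -
    have S: "(\<Sum>m\<in>UNIV. christoffel g i i m (axis p t) * christoffel g m p p (axis p t)
                 - christoffel g i p m (axis p t) * christoffel g m i p (axis p t)) = - (\<alpha> t * t)\<^sup>2"
      by (subst sum_eq_single[where i=i]) (use ip in \<open>auto simp: christoffel_at G power2_eq_square\<close>)
    have "riemann g i p i p (axis p t) = \<beta> t + \<gamma> t * t\<^sup>2 - \<alpha>' t * t - \<alpha> t - (\<alpha> t * t)\<^sup>2"
      unfolding riemann_def S pc using ip t0 by (simp add: power2_eq_square)
    also have "\<dots> = - f2 t / f t"
      unfolding gamma_t using t0 f0 by (simp add: \<alpha>_def \<alpha>'_def \<beta>_def field_simps power2_eq_square power3_eq_cube)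
    finally show ?thesis .
  qed
  show "riemann g p k p k (axis p t) = - f t * f2 t / t\<^sup>2" if kp: "k \<noteq> p"
  proof -
    have S: "(\<Sum>m\<in>UNIV. christoffel g p p m (axis p t) * christoffel g m k k (axis p t)
                 - christoffel g p k m (axis p t) * christoffel g m p k (axis p t)) = - \<beta> t * \<alpha> t * t\<^sup>2"
      by (subst sum_eq_single[where i=k]) (use kp in \<open>auto simp: christoffel_at G power2_eq_square\<close>)
    have "riemann g p k p k (axis p t) = \<beta>' t * t + \<beta> t - \<alpha> t - \<gamma> t * t\<^sup>2 - \<beta> t * \<alpha> t * t\<^sup>2"
      unfolding riemann_def S pc using kp t0 by (simp add: power2_eq_square)
    also have "\<dots> = - f t * f2 t / t\<^sup>2"
      unfolding gamma_t using t0 f0 by (simp add: \<alpha>_def \<beta>'_def \<beta>_def field_simps power2_eq_square power3_eq_cube power4_eq_xxxx)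
    finally show ?thesis .
  qed
  show "riemann g i k i k (axis p t) = (1 - (f1 t)\<^sup>2) / t\<^sup>2" if ik: "i \<noteq> p" "k \<noteq> p" "i \<noteq> k"
  proof -
    have S: "(\<Sum>m\<in>UNIV. christoffel g i i m (axis p t) * christoffel g m k k (axis p t)
                 - christoffel g i k m (axis p t) * christoffel g m i k (axis p t)) = \<alpha> t * \<beta> t * t\<^sup>2"
      by (subst sum_eq_single[where i=p]) (use ik in \<open>auto simp: christoffel_at G power2_eq_square\<close>)
    have "riemann g i k i k (axis p t) = \<beta> t - \<alpha> t + \<alpha> t * \<beta> t * t\<^sup>2"
      unfolding riemann_def S pc using ik t0 by (simp add: power2_eq_square)
    also have "\<dots> = (1 - (f1 t)\<^sup>2) / t\<^sup>2"
      using t0 f0 by (simp add: \<alpha>_def \<beta>_def field_simps power2_eq_square power3_eq_cube power4_eq_xxxx)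
    finally show ?thesis .
  qed
qed

lemma ricci_radial: "ricci g (axis p t) $ p $ p = - (real CARD('n) - 1) * f2 t / f t"
proof -
  have "ricci g (axis p t) $ p $ p = (\<Sum>i\<in>UNIV. riemann g i p i p (axis p t))"
    by (simp add: ricci_def)
  also have "\<dots> = (\<Sum>i\<in>UNIV - {p}. riemann g i p i p (axis p t))"
    by (subst sum.remove[where x=p]) (auto simp: riemann_values(1))
  also have "\<dots> = (\<Sum>i\<in>UNIV - {p}. - f2 t / f t)"
    by (intro sum.cong refl riemann_values(2)) auto
  also have "\<dots> = - (real CARD('n) - 1) * f2 t / f t"
    by (simp add: of_nat_diff algebra_simps diff_divide_distrib)
  finally show ?thesis .
qed

lemma ricci_tangential:
  assumes k: "k \<noteq> p"
  shows "ricci g (axis p t) $ k $ k = - f t * f2 t / t\<^sup>2 + (real CARD('n) - 2) * (1 - (f1 t)\<^sup>2) / t\<^sup>2"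
proof -
  have "ricci g (axis p t) $ k $ k = (\<Sum>i\<in>UNIV. riemann g i k i k (axis p t))"
    by (simp add: ricci_def)
  also have "\<dots> = riemann g p k p k (axis p t) + (\<Sum>i\<in>UNIV - {p} - {k}. riemann g i k i k (axis p t))"
    using k by (subst sum.remove[where x=p], simp, simp, subst sum.remove[where x=k])
      (auto simp: riemann_values(1))
  also have "(\<Sum>i\<in>UNIV - {p} - {k}. riemann g i k i k (axis p t)) = (\<Sum>i\<in>UNIV - {p} - {k}. (1 - (f1 t)\<^sup>2) / t\<^sup>2)"
    by (intro sum.cong refl riemann_values(4)) (use k in auto)
  also have "\<dots> = (real CARD('n) - 2) * ((1 - (f1 t)\<^sup>2) / t\<^sup>2)"
  proof -
    have "card {p, k} \<le> CARD('n)" by (rule card_mono) auto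
    then have "card (UNIV - {p} - {k}) = CARD('n) - 2" "2 \<le> CARD('n)"
      using k by (simp_all add: card_Diff_singleton)
    then show ?thesis by (simp add: of_nat_diff)
  qed
  finally show ?thesis by (simp add: riemann_values(3)[OF k])
qed

lemma metric_radial: "g (axis p t) $ p $ p = 1"
  using t by (simp add: g_eq[OF xp(1)] xp(2,3) B_def power2_eq_square)

lemma scalar_curv_eq:
  "scalar_curv g (axis p t) = (real CARD('n) - 1) *
     ((real CARD('n) - 2) * (1 - (f1 t)\<^sup>2) / (f t)\<^sup>2 - 2 * f2 t / f t)"
proof -
  have t0: "t \<noteq> 0" and f0: "f t \<noteq> 0" using t f_pos[OF t] by auto
  have inv: "matrix_inv (g (axis p t)) $ i $ j = (if i = p then 1 else t\<^sup>2 / (f t)\<^sup>2) * kd i j" for i j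
    unfolding matrix_inv_g[OF xp(1)] xp(2,3) using t0 by (auto simp: A_def power2_eq_square)
  have "scalar_curv g (axis p t) = (\<Sum>i\<in>UNIV. (if i = p then 1 else t\<^sup>2 / (f t)\<^sup>2) * ricci g (axis p t) $ i $ i)"
  proof -
    have "(\<Sum>j\<in>UNIV. matrix_inv (g (axis p t)) $ i $ j * ricci g (axis p t) $ i $ j)
       = (\<Sum>j\<in>UNIV. kd i j * ((if i = p then 1 else t\<^sup>2 / (f t)\<^sup>2) * ricci g (axis p t) $ i $ j))" for i
      unfolding inv by (intro sum.cong refl) simp
    then show ?thesis unfolding scalar_curv_def sum_kd by simp
  qed
  also have "\<dots> = ricci g (axis p t) $ p $ p +
      (\<Sum>k\<in>UNIV - {p}. t\<^sup>2 / (f t)\<^sup>2 * (- f t * f2 t / t\<^sup>2 + (real CARD('n) - 2) * (1 - (f1 t)\<^sup>2) / t\<^sup>2))"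
    by (subst sum.remove[where x=p]) (auto simp: ricci_tangential intro!: sum.cong)
  also have "\<dots> = (real CARD('n) - 1) *
     ((real CARD('n) - 2) * (1 - (f1 t)\<^sup>2) / (f t)\<^sup>2 - 2 * f2 t / f t)"
    unfolding ricci_radial using t0 f0 by (simp add: of_nat_diff field_simps power2_eq_square)
  finally show ?thesis .
qed

end

end

section \<open>Regularity of the warping function\<close>

lemma smooth_on_imp_differentiable:
  assumes "smooth_on U F" "open U" "x \<in> U"
  shows "F differentiable (at x)" "partial i F differentiable (at x)"
proof -
  have "iter_partial [] F differentiable_on U" "iter_partial [i] F differentiable_on U"
    using assms(1) unfolding smooth_on_def by blast+
  then show "F differentiable (at x)" "partial i F differentiable (at x)"
    using assms(2,3) by (auto simp: differentiable_on_eq_differentiable_at)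
qed

lemma has_real_derivative_along_axis:
  fixes F :: "real^'n \<Rightarrow> real"
  assumes "F differentiable (at (axis p t))"
  shows "((\<lambda>t. F (axis p t)) has_real_derivative partial p F (axis p t)) (at t)"
proof -
  have 1: "((\<lambda>s. axis p s :: real^'n) has_derivative axis p) (at t)"
    by (intro bounded_linear_imp_has_derivative linear_conv_bounded_linear[THEN iffD1] linearI)
       (simp_all add: axis_def vec_eq_iff)
  have 2: "(F has_derivative frechet_derivative F (at (axis p t))) (at (axis p t))"
    using assms by (simp add: frechet_derivative_works)
  have "((\<lambda>s. F (axis p s)) has_derivative (\<lambda>h. frechet_derivative F (at (axis p t)) (axis p h))) (at t)"
    by (rule has_derivative_compose[OF 1 2])
  moreover have "frechet_derivative F (at (axis p t)) (axis p h) = partial p F (axis p t) * h" for h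
  proof -
    have "axis p h = h *\<^sub>R axis p 1" by (simp add: axis_def vec_eq_iff)
    then show ?thesis
      using linear_cmul[OF has_derivative_linear[OF 2], of h "axis p 1"] by (simp add: partial_def mult.commute)
  qed
  ultimately show ?thesis by (simp add: has_field_derivative_def)
qed

lemma axis_symmetric_manifoldD:
  assumes "axis_symmetric_manifold a f g h"
  shows "a > 0" "f 0 = 0" "f a = 0" "\<And>t. t \<in> {0<..<a} \<Longrightarrow> f t > 0"
    "riemannian_metric_on (ball 0 a) g"
    "\<And>x. x \<in> ball 0 a - {0} \<Longrightarrow> g x = warped_metric f norm sgn x"
  using assms by (simp_all add: axis_symmetric_manifold_def)

text \<open>On a coordinate axis, a diagonal component of the metric in a direction orthogonal to that
  axis is \<open>f(t)\<^sup>2 / t\<^sup>2\<close>. Its smoothness gives the differentiability of f, and its continuity at the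
  origin gives the linear bound at the pole.\<close>

lemma warping_function_regular:
  fixes g :: "real^'n \<Rightarrow> real^'n^'n"
  assumes n: "CARD('n) \<ge> 2" and M: "axis_symmetric_manifold a f g h"
  obtains f1 f2 C d where
    "\<forall>t\<in>{0<..<a}. (f has_real_derivative f1 t) (at t)"
    "\<forall>t\<in>{0<..<a}. (f1 has_real_derivative f2 t) (at t)"
    "d > 0" "\<forall>t. 0 < t \<longrightarrow> t < d \<longrightarrow> f t \<le> C * t"
proof -
  note a = axis_symmetric_manifoldD(1)[OF M] and f_pos = axis_symmetric_manifoldD(4)[OF M]
    and metric = axis_symmetric_manifoldD(5)[OF M] and g = axis_symmetric_manifoldD(6)[OF M]
  obtain p j :: 'n where pj: "j \<noteq> p"
  proof -
    have "\<not> CARD('n) \<le> Suc 0" using n by simp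
    then show ?thesis using that by (auto simp: card_le_Suc0_iff_eq)
  qed
  define G where "G x = g x $ j $ j" for x
  define F where "F t = G (axis p t)" for t
  define F1 where "F1 t = partial p G (axis p t)" for t
  have G_smooth: "smooth_on (ball 0 a) G"
    using metric unfolding riemannian_metric_on_def G_def by simp
  have ax: "axis p t \<in> ball 0 a - {0::real^'n}" "norm (axis p t) = t" if "t \<in> {0<..<a}" for t
    using that by (auto simp: norm_eq_sqrt_inner inner_axis_axis dist_norm)
  have F_eq: "F t = (f t)\<^sup>2 / t\<^sup>2" if "t \<in> {0<..<a}" for t
    using ax[OF that] pj g[OF ax(1)[OF that]] warped_metric_radial[of "axis p t" f j j]
    by (simp add: F_def G_def axis_def)
  have F_pos: "F t > 0" if "t \<in> {0<..<a}" for t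
    using f_pos[OF that] that by (simp add: F_eq)
  have f_eq: "f t = t * sqrt (F t)" if "t \<in> {0<..<a}" for t
    using f_pos[OF that] that by (simp add: F_eq real_sqrt_divide)
  have dF: "(F has_real_derivative F1 t) (at t)" "F1 differentiable (at t)" if "t \<in> {0<..<a}" for t
  proof -
    have D: "G differentiable (at (axis p t))" "partial p G differentiable (at (axis p t))"
      using smooth_on_imp_differentiable(1)[OF G_smooth open_ball, where x="axis p t"]
        smooth_on_imp_differentiable(2)[OF G_smooth open_ball, where x="axis p t" and i=p] ax[OF that] by auto
    show "(F has_real_derivative F1 t) (at t)" "F1 differentiable (at t)"
      unfolding F_def[abs_def] F1_def[abs_def]
      using has_real_derivative_along_axis[OF D(1)] has_real_derivative_along_axis[OF D(2)]
      unfolding real_differentiable_def by blast+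
  qed
  define f1 where "f1 t = sqrt (F t) + t * (F1 t / (2 * sqrt (F t)))" for t
  have df: "(f has_real_derivative f1 t) (at t)" if t: "t \<in> {0<..<a}" for t
  proof -
    have "((\<lambda>t. t * sqrt (F t)) has_real_derivative f1 t) (at t)"
      unfolding f1_def
      by (rule DERIV_cong[OF DERIV_mult[OF DERIV_ident DERIV_chain2[OF DERIV_real_sqrt[OF F_pos[OF t]] dF(1)[OF t]]]])
         (simp add: field_simps)
    then show ?thesis
      by (rule has_field_derivative_transform_within_open[of _ _ _ "{0<..<a}"]) (use t f_eq in auto)
  qed
  have df1: "(f1 has_real_derivative deriv f1 t) (at t)" if t: "t \<in> {0<..<a}" for t
  proof -
    have "F differentiable (at t)" using dF(1)[OF t] unfolding real_differentiable_def by blast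
    moreover have "(\<lambda>t. sqrt (F t)) differentiable (at t)"
      using DERIV_chain2[OF DERIV_real_sqrt[OF F_pos[OF t]] dF(1)[OF t]] unfolding real_differentiable_def by blast
    ultimately have "f1 differentiable (at t)"
      unfolding f1_def[abs_def] using dF(2)[OF t] F_pos[OF t]
      by (intro derivative_intros) auto
    then show ?thesis by (simp add: DERIV_deriv_iff_real_differentiable)
  qed
  have "isCont G 0"
    using smooth_on_imp_differentiable(1)[OF G_smooth open_ball, where x=0] a
    by (simp add: differentiable_imp_continuous_within)
  then obtain d where d: "d > 0" "\<And>x. norm x < d \<Longrightarrow> \<bar>G x - G 0\<bar> < 1"
    unfolding continuous_at_eps_delta by (auto simp: dist_norm dist_real_def dest: spec[of _ 1])
  have "f t \<le> sqrt (G 0 + 1) * t" if "0 < t" "t < min a d" for t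
  proof -
    have t: "t \<in> {0<..<a}" using that by simp
    have "F t \<le> G 0 + 1" using d(2)[of "axis p t"] ax(2)[OF t] that by (simp add: F_def)
    then have "sqrt (F t) * t \<le> sqrt (G 0 + 1) * t" using that by (intro mult_right_mono) auto
    then show ?thesis by (simp add: f_eq[OF t] mult.commute)
  qed
  with df df1 show ?thesis using that[of f1 "deriv f1" "min a d" "sqrt (G 0 + 1)"] a d(1) by auto
qed

lemma axis_symmetric_manifold_flip:
  assumes "axis_symmetric_manifold a f g h"
  shows "axis_symmetric_manifold a (\<lambda>t. f (a - t)) h g"
proof -
  have ind: "induced_metric (\<lambda>y. a - norm y) x = induced_metric norm x" if "x \<noteq> 0" for x :: "real^'n"
  proof -
    have "partial i (\<lambda>y. a - norm y) x = - partial i norm x" for i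
    proof -
      have "((\<lambda>y. a - norm y) has_derivative (\<lambda>h. 0 - (x \<bullet> h) / norm x)) (at x)"
        by (intro has_derivative_diff has_derivative_const has_derivative_norm' that)
      from partial_eq[OF this] show ?thesis using that by (simp add: partial_norm inner_axis)
    qed
    then show ?thesis by (simp add: induced_metric_def)
  qed
  show ?thesis
    using assms unfolding axis_symmetric_manifold_def warped_metric_def
    by (auto simp: ind)
qed

lemma tendsto_warping_function_pole:
  fixes g :: "real^'n \<Rightarrow> real^'n^'n"
  assumes n: "CARD('n) \<ge> 2" and M: "axis_symmetric_manifold a f g h"
  shows "(f \<longlongrightarrow> 0) (at_right 0)"
proof -
  note M' = axis_symmetric_manifoldD[OF M]
  obtain f1 f2 C d where
    d: "d > 0" "\<forall>t. 0 < t \<longrightarrow> t < d \<longrightarrow> f t \<le> C * t"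
    by (rule warping_function_regular[OF n M]) (rule that)
  have ev: "eventually (\<lambda>t. t \<in> {0<..<min a d}) (at_right 0)"
    by (rule eventually_at_right_real) (use M'(1) d in auto)
  show ?thesis
  proof (rule tendsto_sandwich)
    show "\<forall>\<^sub>F t in at_right 0. 0 \<le> f t"
      using ev by eventually_elim (use M'(4) in \<open>auto intro: less_imp_le\<close>)
    show "\<forall>\<^sub>F t in at_right 0. f t \<le> C * t"
      using ev by eventually_elim (use d in auto)
    show "((\<lambda>t. C * t) \<longlongrightarrow> 0) (at_right 0)"
      by (rule tendsto_eq_intros refl)+ simp
  qed simp
qed

lemma continuous_on_warping_function:
  fixes g :: "real^'n \<Rightarrow> real^'n^'n"
  assumes n: "CARD('n) \<ge> 2" and M: "axis_symmetric_manifold a f g h"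
  shows "continuous_on {0..a} f"
proof (rule continuous_on_IccI)
  note M' = axis_symmetric_manifoldD[OF M]
  show "(f \<longlongrightarrow> f 0) (at_right 0)"
    using tendsto_warping_function_pole[OF n M] M' by simp
  have "((\<lambda>t. f (a - t)) \<longlongrightarrow> 0) (at_right 0)"
    by (rule tendsto_warping_function_pole[OF n axis_symmetric_manifold_flip[OF M]])
  then have "((\<lambda>t. f (a - (a - t))) \<longlongrightarrow> 0) (at_left a)"
  proof (rule filterlim_compose)
    have "((\<lambda>t. a - t) \<longlongrightarrow> 0) (at_left a)"
      by (rule tendsto_eq_intros refl)+ simp
    moreover have "\<forall>\<^sub>F t in at_left a. a - t \<in> {0<..} \<and> a - t \<noteq> 0"
      unfolding eventually_at_filter by (rule always_eventually) auto
    ultimately show "filterlim (\<lambda>t. a - t) (at_right 0) (at_left a)"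
      by (simp add: filterlim_at)
  qed
  then show "(f \<longlongrightarrow> f a) (at_left a)" using M' by simp
  show "f \<midarrow>t\<rightarrow> f t" if "0 < t" "t < a" for t
  proof -
    obtain f1 f2 C d where
      "\<forall>t\<in>{0<..<a}. (f has_real_derivative f1 t) (at t)"
      by (rule warping_function_regular[OF n M]) (rule that)
    then have "isCont f t" using that by (intro DERIV_isCont[of f "f1 t"]) simp
    then show ?thesis by (simp add: isCont_def)
  qed
qed (rule axis_symmetric_manifoldD[OF M])

text \<open>The step from the geometric hypotheses to the differential inequalities for f.\<close>

lemma integral_power_half_le:
  fixes g :: "real^'n \<Rightarrow> real^'n^'n" and k :: nat and \<epsilon> :: real
  defines "W \<equiv> sin_power_primitive (k + 2) (pi / 2)"
  assumes n: "CARD('n) = k + 3" and M: "axis_symmetric_manifold a f g h"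
    and eps: "0 < \<epsilon>" "real (k + 2) * W - 1 \<le> \<epsilon> * (real (k + 2) * W)"
    and ric: "\<And>x v. x \<in> ball 0 a \<Longrightarrow> v \<bullet> (ricci g x *v v) \<ge> \<epsilon> * (real CARD('n) - 1) * (v \<bullet> (g x *v v))"
    and scal: "\<And>x. x \<in> ball 0 a \<Longrightarrow> scalar_curv g x \<ge> real CARD('n) * (real CARD('n) - 1)"
    and t0: "t0 \<in> {0<..<a}" and max: "\<And>t. t \<in> {0..a} \<Longrightarrow> f t \<le> f t0"
  shows "integral {0..t0} (\<lambda>t. f t ^ (k + 2)) \<le> W"
proof -
  note M' = axis_symmetric_manifoldD[OF M]
  have n2: "CARD('n) \<ge> 2" using n by simp
  obtain f1 f2 C d where
    "\<forall>t\<in>{0<..<a}. (f has_real_derivative f1 t) (at t)"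
    "\<forall>t\<in>{0<..<a}. (f1 has_real_derivative f2 t) (at t)" and
    d: "d > 0" "\<forall>t. 0 < t \<longrightarrow> t < d \<longrightarrow> f t \<le> C * t"
    by (rule warping_function_regular[OF n2 M]) (rule that)
  then have df: "\<And>t. t \<in> {0<..<a} \<Longrightarrow> (f has_real_derivative f1 t) (at t)" and
    df1: "\<And>t. t \<in> {0<..<a} \<Longrightarrow> (f1 has_real_derivative f2 t) (at t)" by blast+
  fix p :: 'n
  have ax: "axis p t \<in> ball 0 a" if "t \<in> {0<..<a}" for t
    using that by (auto simp: norm_eq_sqrt_inner inner_axis_axis dist_norm)
  have pp: "axis p 1 \<bullet> (A *v axis p 1) = A $ p $ p" for A :: "real^'n^'n"
    by (simp add: matrix_vector_mult_basis column_def inner_axis')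
  have le: "0 < t \<Longrightarrow> t \<le> t0 \<Longrightarrow> t \<in> {0<..<a}" for t using t0 by auto
  have f2: "f2 t \<le> - \<epsilon> * f t" if t: "t \<in> {0<..<a}" for t
  proof -
    have c: "real CARD('n) - 1 = real k + 2" by (simp add: n)
    have r: "ricci g (axis p t) $ p $ p = - (real CARD('n) - 1) * f2 t / f t"
      using df df1 M'(4) M'(6) t by (rule ricci_radial)
    have m: "g (axis p t) $ p $ p = 1"
      using df df1 M'(4) M'(6) t by (rule metric_radial)
    have "\<epsilon> * (real CARD('n) - 1) * 1 \<le> - (real CARD('n) - 1) * f2 t / f t"
      using ric[OF ax[OF t], of "axis p 1"] unfolding pp r m .
    then have "(real k + 2) * \<epsilon> \<le> (real k + 2) * (- f2 t / f t)"
      unfolding c by (simp only: mult.commute[of \<epsilon>] mult_1_right mult_minus_left mult_minus_right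
          times_divide_eq_right minus_divide_left)
    then have "\<epsilon> \<le> - f2 t / f t" by (rule mult_left_le_imp_le) simp
    then show ?thesis using M'(4)[OF t] by (simp add: field_simps)
  qed
  have sc: "real (k + 3) * (f t)\<^sup>2 \<le> - 2 * f t * f2 t + real (k + 1) * (1 - (f1 t)\<^sup>2)"
    if t: "t \<in> {0<..<a}" for t
  proof -
    have "(real k + 2) * (real k + 3) \<le> (real k + 2) * ((real k + 1) * (1 - (f1 t)\<^sup>2) / (f t)\<^sup>2 - 2 * f2 t / f t)"
    proof -
      have r: "scalar_curv g (axis p t) = (real CARD('n) - 1) *
         ((real CARD('n) - 2) * (1 - (f1 t)\<^sup>2) / (f t)\<^sup>2 - 2 * f2 t / f t)"
        using df df1 M'(4) M'(6) t by (rule scalar_curv_eq)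
      have c: "real CARD('n) = real k + 3" "real k + 3 - 1 = real k + 2" "real k + 3 - 2 = real k + 1"
        by (simp_all add: n)
      show ?thesis using scal[OF ax[OF t]] unfolding r c by (simp only: mult.commute)
    qed
    then have "real k + 3 \<le> (real k + 1) * (1 - (f1 t)\<^sup>2) / (f t)\<^sup>2 - 2 * f2 t / f t"
      by (rule mult_left_le_imp_le) simp
    then have "(real k + 3) * (f t)\<^sup>2 \<le> ((real k + 1) * (1 - (f1 t)\<^sup>2) / (f t)\<^sup>2 - 2 * f2 t / f t) * (f t)\<^sup>2"
      by (rule mult_right_mono) simp
    also have "\<dots> = (real k + 1) * (1 - (f1 t)\<^sup>2) - 2 * f t * f2 t"
      using M'(4)[OF t] by (simp add: field_simps power2_eq_square)
    finally show ?thesis by (simp add: add.commute[of 1])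
  qed
  have "f1 t0 = 0"
  proof (rule DERIV_local_max[OF df[OF t0]])
    show "0 < min t0 (a - t0)" using t0 by auto
    show "\<forall>y. \<bar>t0 - y\<bar> < min t0 (a - t0) \<longrightarrow> f y \<le> f t0"
      by (intro allI impI max) (auto simp: abs_less_iff)
  qed
  moreover have "continuous_on {0..t0} f"
    by (rule continuous_on_subset[OF continuous_on_warping_function[OF n2 M]]) (use t0 in auto)
  ultimately show ?thesis
    unfolding W_def
    by (intro integral_power_ascending_le[where f=f and ?f1.0=f1 and ?f2.0=f2 and C=C and \<epsilon>=\<epsilon> and d=d]
        M'(2,4) df df1 le f2 sc eps[unfolded W_def] d(1) d(2)[rule_format]) (use t0 in auto)
qed

section \<open>Volumes\<close>

text \<open>Both measures give the half-line \<open>{..r}\<close> the volume of the ball of radius r, and the half-lines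
  generate the Borel sets.\<close>

lemma distr_norm_lborel:
  "distr lborel borel (norm :: 'a::euclidean_space \<Rightarrow> real) =
     density lborel (\<lambda>r. ennreal (real DIM('a) * unit_ball_vol (real DIM('a)) * r ^ (DIM('a) - 1)) * indicator {0..} r)"
    (is "?L = ?R")
proof (rule measure_eqI_generator_eq[where E="range (\<lambda>r::real. {..r})" and \<Omega>=UNIV and A="\<lambda>i::nat. {..real i}"])
  define \<omega> where "\<omega> = unit_ball_vol (real DIM('a))"
  have \<omega>: "\<omega> \<ge> 0" by (simp add: \<omega>_def)
  have L: "emeasure ?L {..r} = (if r \<ge> 0 then ennreal (\<omega> * r ^ DIM('a)) else 0)" for r
  proof -
    have "emeasure ?L {..r} = emeasure lborel (cball (0::'a) r)"
      by (subst emeasure_distr) (auto simp: cball_def intro!: arg_cong[where f="emeasure lborel"])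
    then show ?thesis by (simp add: \<omega>_def emeasure_cball)
  qed
  have R: "emeasure ?R {..r} = (if r \<ge> 0 then ennreal (\<omega> * r ^ DIM('a)) else 0)" for r
  proof -
    have "emeasure ?R {..r} =
        (\<integral>\<^sup>+x. ennreal (real DIM('a) * \<omega> * x ^ (DIM('a) - 1)) * indicator {0..r} x \<partial>lborel)"
      by (subst emeasure_density) (auto simp: \<omega>_def indicator_def intro!: nn_integral_cong)
    also have "\<dots> = (if r \<ge> 0 then ennreal (\<omega> * r ^ DIM('a)) else 0)"
    proof (cases "r \<ge> 0")
      case True
      have "(\<integral>\<^sup>+x. ennreal (real DIM('a) * \<omega> * x ^ (DIM('a) - 1)) * indicator {0..r} x \<partial>lborel)
          = ennreal (\<omega> * r ^ DIM('a) - \<omega> * 0 ^ DIM('a))"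
      proof (rule nn_integral_FTC_Icc)
        show "((\<lambda>x. \<omega> * x ^ DIM('a)) has_real_derivative real DIM('a) * \<omega> * x ^ (DIM('a) - 1)) (at x)" for x
          by (auto intro!: derivative_eq_intros)
      qed (use True \<omega> in auto)
      then show ?thesis using True by (simp add: power_0_left)
    next
      case False
      then show ?thesis by simp
    qed
    finally show ?thesis .
  qed
  show "emeasure ?L X = emeasure ?R X" if "X \<in> range (\<lambda>r::real. {..r})" for X
    using that L R by auto
  show "emeasure ?L {..real i} \<noteq> \<infinity>" for i :: nat
    by (simp add: L)
  show "Int_stable (range (\<lambda>r::real. {..r}))"
    by (auto simp: Int_stable_def)
  show "sets ?L = sigma_sets UNIV (range (\<lambda>r::real. {..r}))" "sets ?R = sigma_sets UNIV (range (\<lambda>r::real. {..r}))"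
    by (simp_all add: borel_eq_atMost)
  show "(\<Union>i::nat. {..real i}) = UNIV"
    using real_arch_simple by auto
qed auto

lemma nn_integral_radial:
  fixes h :: "real \<Rightarrow> ennreal"
  assumes [measurable]: "h \<in> borel_measurable borel"
  shows "(\<integral>\<^sup>+x. h (norm (x :: 'a::euclidean_space)) \<partial>lborel) =
    (\<integral>\<^sup>+r. ennreal (real DIM('a) * unit_ball_vol (real DIM('a)) * r ^ (DIM('a) - 1)) * indicator {0..} r * h r \<partial>lborel)"
proof -
  have "(\<integral>\<^sup>+x. h (norm (x :: 'a)) \<partial>lborel) = (\<integral>\<^sup>+r. h r \<partial>distr lborel borel (norm :: 'a \<Rightarrow> real))"
    by (subst nn_integral_distr) auto
  also have "\<dots> = (\<integral>\<^sup>+r. ennreal (real DIM('a) * unit_ball_vol (real DIM('a)) * r ^ (DIM('a) - 1)) * indicator {0..} r * h r \<partial>lborel)"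
    unfolding distr_norm_lborel by (subst nn_integral_density) auto
  finally show ?thesis .
qed

abbreviation sphere_area :: "nat \<Rightarrow> real" where
  "sphere_area n \<equiv> real n * unit_ball_vol (real n)"

lemma induced_metric_inv_stereo:
  fixes x :: "real^'n"
  shows "induced_metric inv_stereo x $ i $ j = (2 / (1 + (norm x)\<^sup>2))\<^sup>2 * kd i j"
proof -
  define q where "q = (norm x)\<^sup>2"
  have q: "1 + q > 0" "x \<bullet> x = q" by (simp_all add: q_def add_pos_nonneg power2_norm_eq_inner)
  define c where "c = 2 / (1 + q)"
  have eq: "inv_stereo y = ((2 / (1 + y \<bullet> y)) *\<^sub>R y, 1 - 2 / (1 + y \<bullet> y))" for y :: "real^'n"
  proof -
    have "1 + y \<bullet> y \<noteq> 0" by (smt (verit) inner_ge_zero)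
    then show ?thesis
      unfolding inv_stereo_def power2_norm_eq_inner by (simp add: field_simps)
  qed
  have d: "((\<lambda>y. 2 / (1 + y \<bullet> y)) has_derivative (\<lambda>h. - (c\<^sup>2 * (x \<bullet> h)))) (at x)"
    using q(1) by (auto intro!: derivative_eq_intros simp: q(2) c_def power2_eq_square inner_commute field_simps)
  have "((inv_stereo :: real^'n \<Rightarrow> _) has_derivative
      (\<lambda>h. (c *\<^sub>R h + (- (c\<^sup>2 * (x \<bullet> h))) *\<^sub>R x, 0 - (- (c\<^sup>2 * (x \<bullet> h)))))) (at x)"
    unfolding eq[abs_def] c_def q(2)[symmetric]
    by (intro has_derivative_Pair has_derivative_scaleR has_derivative_diff has_derivative_const has_derivative_ident
        d[unfolded c_def q(2)[symmetric]])
  from partial_eq[OF this]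
  have p: "partial i inv_stereo x = (c *\<^sub>R axis i 1 - (c\<^sup>2 * x $ i) *\<^sub>R x, c\<^sup>2 * x $ i)" for i
    by (simp add: inner_axis)
  have ax: "axis i 1 \<bullet> axis j (1::real) = kd i j" "axis i 1 \<bullet> x = x $ i" "x \<bullet> axis j 1 = x $ j"
    by (simp add: inner_axis, simp add: axis_def, simp_all add: inner_axis inner_axis')
  have "induced_metric inv_stereo x $ i $ j = c\<^sup>2 * kd i j + c ^ 3 * (x $ i * x $ j) * (c * (1 + q) - 2)"
    unfolding induced_metric_def vec_lambda_beta p inner_Pair inner_diff_left inner_diff_right
      inner_scaleR_left inner_scaleR_right ax q(2) inner_real_def
    by (simp add: algebra_simps power2_eq_square power3_eq_cube)
  also have "c * (1 + q) = 2" using nonzero_eq_divide_eq[THEN iffD1, OF _ c_def] q(1) by simp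
  finally show ?thesis by (simp add: c_def q_def)
qed

text \<open>The stereographic metric is conformal, with volume density \<open>(2 / (1 + r\<^sup>2))\<^sup>n\<close>. Under
  \<open>r = tan (\<theta>/2)\<close> the radial integral becomes that of \<open>sin\<^sup>n\<^sup>-\<^sup>1 \<theta>\<close> over \<open>[0, \<pi>]\<close>.\<close>

lemma round_sphere_volume_eq:
  "round_sphere_volume TYPE('n::finite) =
     ennreal (sphere_area CARD('n) * (2 * sin_power_primitive (CARD('n) - 1) (pi / 2)))"
proof -
  define m where "m = CARD('n) - 1"
  define \<kappa> where "\<kappa> = sphere_area CARD('n)"
  have m: "CARD('n) = Suc m" by (simp add: m_def)
  have \<kappa>: "\<kappa> \<ge> 0" by (simp add: \<kappa>_def)
  have "det (induced_metric inv_stereo x) = ((2 / (1 + (norm x)\<^sup>2)) ^ CARD('n))\<^sup>2" for x :: "real^'n"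
  proof -
    have "det (induced_metric inv_stereo x) = (\<Prod>i\<in>(UNIV :: 'n set). (2 / (1 + (norm x)\<^sup>2))\<^sup>2)"
      by (subst det_diagonal) (simp_all add: induced_metric_inv_stereo)
    then show ?thesis
      by (simp only: prod_constant power_mult[symmetric] mult.commute)
  qed
  then have "round_sphere_volume TYPE('n) = (\<integral>\<^sup>+x. ennreal ((2 / (1 + (norm (x :: real^'n))\<^sup>2)) ^ Suc m) \<partial>lborel)"
    unfolding round_sphere_volume_def riem_volume_def m by simp
  also have "\<dots> = (\<integral>\<^sup>+r. ennreal (\<kappa> * r ^ m) * indicator {0..} r * ennreal ((2 / (1 + r\<^sup>2)) ^ Suc m) \<partial>lborel)"
    by (subst nn_integral_radial) (simp_all add: \<kappa>_def m)
  also have "\<dots> = (\<integral>\<^sup>+r. ennreal (\<kappa> * (sin (2 * arctan r) ^ m * (2 / (1 + r\<^sup>2)))) * indicator {0..} r \<partial>lborel)"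
  proof (intro nn_integral_cong)
    fix r :: real
    define c where "c = 2 / (1 + r\<^sup>2)"
    have "sin (2 * arctan r) = r * c"
      by (simp add: c_def sin_double sin_arctan cos_arctan)
    then have "\<kappa> * (sin (2 * arctan r) ^ m * c) = \<kappa> * r ^ m * c ^ Suc m"
      by (simp add: power_mult_distrib)
    then have "\<kappa> * (sin (2 * arctan r) ^ m * (2 / (1 + r\<^sup>2))) = \<kappa> * r ^ m * (2 / (1 + r\<^sup>2)) ^ Suc m"
      by (simp only: c_def)
    moreover have "ennreal (\<kappa> * r ^ m * (2 / (1 + r\<^sup>2)) ^ Suc m) =
        ennreal (\<kappa> * r ^ m) * ennreal ((2 / (1 + r\<^sup>2)) ^ Suc m)" if "r \<ge> 0"
      by (rule ennreal_mult') (use that \<kappa> in simp)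
    ultimately show "ennreal (\<kappa> * r ^ m) * indicator {0..} r * ennreal ((2 / (1 + r\<^sup>2)) ^ Suc m) =
        ennreal (\<kappa> * (sin (2 * arctan r) ^ m * (2 / (1 + r\<^sup>2)))) * indicator {0..} r"
      by (cases "r \<ge> 0") (simp_all only: indicator_def atLeast_iff of_bool_eq simp_thms mult_1_right mult_zero_left mult_zero_right)
  qed
  also have "\<dots> = ennreal (\<kappa> * sin_power_primitive m pi - \<kappa> * sin_power_primitive m (2 * arctan 0))"
  proof (rule nn_integral_FTC_atLeast[where F="\<lambda>r. \<kappa> * sin_power_primitive m (2 * arctan r)" and a=0])
    fix r :: real assume r: "0 \<le> r"
    have "((\<lambda>r. 2 * arctan r) has_real_derivative 2 / (1 + r\<^sup>2)) (at r)"
      by (auto intro!: derivative_eq_intros simp: divide_inverse)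
    from DERIV_cmult[OF DERIV_chain2[OF has_real_derivative_sin_power_primitive this], of \<kappa>]
    show "((\<lambda>r. \<kappa> * sin_power_primitive m (2 * arctan r)) has_real_derivative
        \<kappa> * (sin (2 * arctan r) ^ m * (2 / (1 + r\<^sup>2)))) (at r)" .
    have "0 \<le> sin (2 * arctan r)"
      using r arctan_ubound[of r] by (intro sin_ge_zero) (auto simp: field_simps)
    then show "0 \<le> \<kappa> * (sin (2 * arctan r) ^ m * (2 / (1 + r\<^sup>2)))"
      using \<kappa> by (simp add: add_nonneg_nonneg)
  next
    have "isCont (sin_power_primitive m) pi"
      by (rule DERIV_isCont[OF has_real_derivative_sin_power_primitive])
    moreover have "((\<lambda>r. 2 * arctan r) \<longlongrightarrow> pi) at_top"
      by (rule tendsto_eq_intros tendsto_arctan_at_top refl)+ simp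
    ultimately show "((\<lambda>r. \<kappa> * sin_power_primitive m (2 * arctan r)) \<longlongrightarrow> \<kappa> * sin_power_primitive m pi) at_top"
      by (rule tendsto_mult[OF tendsto_const isCont_tendsto_compose])
  next
    have "1 + r\<^sup>2 \<noteq> 0" for r :: real by (smt (verit) zero_le_power2)
    then show "(\<lambda>r. \<kappa> * (sin (2 * arctan r) ^ m * (2 / (1 + r\<^sup>2)))) \<in> borel_measurable borel"
      by (intro borel_measurable_continuous_onI continuous_intros) auto
  qed
  finally show ?thesis
    by (simp add: sin_power_primitive_0 sin_power_primitive_pi \<kappa>_def m_def mult_ac)
qed

text \<open>The volume density \<open>(f(r) / r)\<^sup>n\<^sup>-\<^sup>1\<close> cancels the factor \<open>r\<^sup>n\<^sup>-\<^sup>1\<close> of polar coordinates.\<close>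

lemma riem_volume_warped:
  fixes g :: "real^'n \<Rightarrow> real^'n^'n"
  assumes f_pos: "\<And>t. t \<in> {0<..<a} \<Longrightarrow> f t > 0" and cont: "continuous_on {0..a} f"
    and g: "\<And>x. x \<in> ball 0 a - {0} \<Longrightarrow> g x = warped_metric f norm sgn x"
  shows "riem_volume (ball 0 a) g = ennreal (sphere_area CARD('n) * integral {0..a} (\<lambda>t. f t ^ (CARD('n) - 1)))"
proof -
  define m where "m = CARD('n) - 1"
  define \<kappa> where "\<kappa> = sphere_area CARD('n)"
  have \<kappa>: "\<kappa> \<ge> 0" by (simp add: \<kappa>_def)
  define h where "h r = ennreal (indicator {0<..<a} r *\<^sub>R (f r / r) ^ m)" for r
  have sqrt_det: "sqrt (det (g x)) = (f (norm x) / norm x) ^ m" if x: "x \<in> ball 0 a - {0}" for x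
  proof -
    define r where "r = norm x"
    have r: "r \<in> {0<..<a}" using x by (auto simp: r_def)
    have "det (g x) = ((f r)\<^sup>2 / r\<^sup>2) ^ m * ((f r)\<^sup>2 / r\<^sup>2 + (1 - (f r)\<^sup>2 / r\<^sup>2) / r\<^sup>2 * (norm x)\<^sup>2)"
      unfolding m_def
      by (rule det_rank_one_update) (use x in \<open>auto simp: g warped_metric_radial r_def\<close>)
    also have "\<dots> = ((f r / r) ^ m)\<^sup>2"
      using r by (simp add: r_def[symmetric] power_divide flip: power_mult) (simp add: mult.commute)
    finally show ?thesis using r f_pos[OF r] by (simp add: r_def)
  qed
  have [measurable]: "h \<in> borel_measurable borel"
  proof -
    have "continuous_on {0<..<a} (\<lambda>r. (f r / r) ^ m)"
      by (intro continuous_intros continuous_on_subset[OF cont]) auto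
    then have "(\<lambda>r. indicator {0<..<a} r *\<^sub>R (f r / r) ^ m) \<in> borel_measurable borel"
      by (intro borel_measurable_continuous_on_indicator) auto
    then show ?thesis unfolding h_def by measurable
  qed
  have "riem_volume (ball 0 a) g = (\<integral>\<^sup>+x. h (norm (x::real^'n)) \<partial>lborel)"
    unfolding riem_volume_def
  proof (rule nn_integral_cong_AE)
    have "AE x in lborel. x \<noteq> (0::real^'n)" by (rule AE_lborel_singleton)
    then show "AE x in lborel. ennreal (sqrt (det (g x))) * indicator (ball 0 a) x = h (norm x)"
    proof eventually_elim
      case (elim x)
      then show ?case
        using sqrt_det[of x] by (auto simp: h_def indicator_def)
    qed
  qed
  also have "\<dots> = (\<integral>\<^sup>+r. ennreal (\<kappa> * r ^ m) * indicator {0..} r * h r \<partial>lborel)"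
    by (subst nn_integral_radial) (simp_all add: \<kappa>_def m_def)
  also have "\<dots> = (\<integral>\<^sup>+r. ennreal (\<kappa> * f r ^ m) * indicator {0<..<a} r \<partial>lborel)"
  proof (intro nn_integral_cong)
    fix r :: real
    show "ennreal (\<kappa> * r ^ m) * indicator {0..} r * h r = ennreal (\<kappa> * f r ^ m) * indicator {0<..<a} r"
    proof (cases "r \<in> {0<..<a}")
      case True
      then have "\<kappa> * r ^ m * (f r / r) ^ m = \<kappa> * f r ^ m" by (simp add: power_divide)
      moreover have "ennreal (\<kappa> * r ^ m * (f r / r) ^ m) = ennreal (\<kappa> * r ^ m) * ennreal ((f r / r) ^ m)"
        by (rule ennreal_mult') (use True \<kappa> in simp)
      ultimately have "ennreal (\<kappa> * r ^ m) * ennreal ((f r / r) ^ m) = ennreal (\<kappa> * f r ^ m)" by (simp only:)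
      moreover have "h r = ennreal ((f r / r) ^ m)" "(indicator {0..} r :: ennreal) = 1" "(indicator {0<..<a} r :: ennreal) = 1"
        using True by (simp_all add: h_def)
      ultimately show ?thesis by (simp only: mult_1_right)
    qed (simp add: h_def)
  qed
  also have "\<dots> = ennreal (\<kappa> * integral {0..a} (\<lambda>t. f t ^ m))"
  proof (rule nn_integral_has_integral_lebesgue')
    show "0 \<le> \<kappa> * f t ^ m" if "t \<in> {0<..<a}" for t using \<kappa> f_pos[OF that] by simp
    have "((\<lambda>t. f t ^ m) has_integral integral {0..a} (\<lambda>t. f t ^ m)) {0..a}"
      by (intro integrable_integral integrable_continuous_real continuous_intros cont)
    then show "((\<lambda>t. \<kappa> * f t ^ m) has_integral \<kappa> * integral {0..a} (\<lambda>t. f t ^ m)) {0<..<a}"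
      by (intro has_integral_mult_right) (simp add: has_integral_Icc_iff_Ioo)
  qed
  finally show ?thesis by (simp add: \<kappa>_def m_def)
qed

section \<open>The volume comparison\<close>

lemma integral_reflect_interval:
  fixes u :: "real \<Rightarrow> real"
  assumes "continuous_on {b..a} u"
  shows "integral {0..a - b} (\<lambda>t. u (a - t)) = integral {b..a} u"
proof -
  have "(u has_integral integral {b..a} u) (cbox b a)"
    using assms by (simp add: integrable_integral integrable_continuous_real)
  from has_integral_affinity[OF this, of "-1" a]
  have "((\<lambda>t. u (a - t)) has_integral integral {b..a} u) ((\<lambda>t. a - t) ` {b..a})"
    by simp
  moreover have "(\<lambda>t. a - t) ` {b..a} = {0..a - b}"
    by (auto simp: image_iff intro: bexI[of _ "a - x" for x])
  ultimately show ?thesis by (simp add: integral_unique)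
qed

theorem theorem1p3:
  assumes "CARD('n::finite) \<ge> 3"
  shows "\<exists>\<epsilon><1::real. \<forall>a f. \<forall>(g :: real^'n \<Rightarrow> real^'n^'n) h.
    axis_symmetric_manifold a f g h \<longrightarrow>
    (\<forall>G\<in>{g, h}. \<forall>x\<in>ball 0 a. \<forall>v.
       v \<bullet> (ricci G x *v v) \<ge> \<epsilon> * (real CARD('n) - 1) * (v \<bullet> (G x *v v))) \<longrightarrow>
    (\<forall>G\<in>{g, h}. \<forall>x\<in>ball 0 a. scalar_curv G x \<ge> real CARD('n) * (real CARD('n) - 1)) \<longrightarrow>
    riem_volume (ball 0 a) g \<le> round_sphere_volume TYPE('n)"
proof -
  obtain k where n: "CARD('n) = k + 3"
    using assms by (metis add.commute le_Suc_ex)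
  have n2: "CARD('n) \<ge> 2" using n by simp
  define W where "W = sin_power_primitive (k + 2) (pi / 2)"
  have W: "real (k + 2) * W > 0"
    using sin_power_primitive_half_pi_pos[of "k + 2", folded W_def] by simp
  \<comment> \<open>The second entry is the value that the estimate needs; the first one makes \<open>\<epsilon>\<close> visibly positive.\<close>
  define \<epsilon> where "\<epsilon> = max (1/2) (1 - 1 / (real (k + 2) * W))"
  have \<epsilon>: "\<epsilon> < 1" "0 < \<epsilon>" using W by (auto simp: \<epsilon>_def)
  have \<epsilon>W: "real (k + 2) * W - 1 \<le> \<epsilon> * (real (k + 2) * W)"
  proof -
    have "(1 - 1 / (real (k + 2) * W)) * (real (k + 2) * W) \<le> \<epsilon> * (real (k + 2) * W)"
      using W by (intro mult_right_mono) (auto simp: \<epsilon>_def)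
    moreover have "(1 - 1 / c) * c = c - 1" if "c > 0" for c :: real
      using that by (simp add: left_diff_distrib)
    ultimately show ?thesis using W by metis
  qed
  have "riem_volume (ball 0 a) g \<le> round_sphere_volume TYPE('n)"
    if M: "axis_symmetric_manifold a f g h"
      and ric: "\<forall>G\<in>{g, h}. \<forall>x\<in>ball 0 a. \<forall>v.
        v \<bullet> (ricci G x *v v) \<ge> \<epsilon> * (real CARD('n) - 1) * (v \<bullet> (G x *v v))"
      and scal: "\<forall>G\<in>{g, h}. \<forall>x\<in>ball 0 a. scalar_curv G x \<ge> real CARD('n) * (real CARD('n) - 1)"
    for a f and g h :: "real^'n \<Rightarrow> real^'n^'n"
  proof -
    note M' = axis_symmetric_manifoldD[OF M]
    have cont: "continuous_on {0..a} f" by (rule continuous_on_warping_function[OF n2 M])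
    obtain t0 where t0: "t0 \<in> {0..a}" and max: "\<And>t. t \<in> {0..a} \<Longrightarrow> f t \<le> f t0"
      using continuous_attains_sup[OF _ _ cont] M'(1) by auto
    have "f t0 > 0" using max[of "a / 2"] M'(4)[of "a / 2"] M'(1) by simp
    then have t0': "t0 \<in> {0<..<a}"
      using t0 M'(2,3) by (cases "t0 = 0"; cases "t0 = a") auto
    have left: "integral {0..t0} (\<lambda>t. f t ^ (k + 2)) \<le> W"
      unfolding W_def
      by (rule integral_power_half_le[OF n M \<epsilon>(2) \<epsilon>W[unfolded W_def] _ _ t0' max])
         (use ric scal in auto)
    have "integral {0..a - t0} (\<lambda>t. f (a - t) ^ (k + 2)) \<le> W"
      unfolding W_def
      by (rule integral_power_half_le[OF n axis_symmetric_manifold_flip[OF M] \<epsilon>(2) \<epsilon>W[unfolded W_def]])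
         (use ric scal t0' max in auto)
    moreover have "integral {0..a - t0} (\<lambda>t. f (a - t) ^ (k + 2)) = integral {t0..a} (\<lambda>t. f t ^ (k + 2))"
      by (rule integral_reflect_interval)
         (use t0 in \<open>auto intro!: continuous_intros continuous_on_subset[OF cont]\<close>)
    moreover have "integral {0..t0} (\<lambda>t. f t ^ (k + 2)) + integral {t0..a} (\<lambda>t. f t ^ (k + 2))
        = integral {0..a} (\<lambda>t. f t ^ (k + 2))"
      using t0 by (intro Henstock_Kurzweil_Integration.integral_combine integrable_continuous_real
          continuous_intros cont) auto
    ultimately have "integral {0..a} (\<lambda>t. f t ^ (k + 2)) \<le> 2 * W"
      using left by simp
    then have "sphere_area CARD('n) * integral {0..a} (\<lambda>t. f t ^ (k + 2)) \<le> sphere_area CARD('n) * (2 * W)"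
      by (rule mult_left_mono) simp
    moreover have "riem_volume (ball 0 a) g =
        ennreal (sphere_area CARD('n) * integral {0..a} (\<lambda>t. f t ^ (k + 2)))"
    proof -
      have "riem_volume (ball 0 a) g =
          ennreal (sphere_area CARD('n) * integral {0..a} (\<lambda>t. f t ^ (CARD('n) - 1)))"
        using M'(4) cont M'(6) by (rule riem_volume_warped)
      then show ?thesis by (simp add: n)
    qed
    moreover have "round_sphere_volume TYPE('n) = ennreal (sphere_area CARD('n) * (2 * W))"
      unfolding round_sphere_volume_eq W_def by (simp add: n)
    ultimately show ?thesis by (simp only: ennreal_leI)
  qed
  with \<epsilon>(1) show ?thesis by blast
qed

end
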